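(* Consider the linear-model selection setting with selected model $\hat k_n$, fixed constant $d\ge 0$ and sequence $\lambda_n\ge(\log n)^{-1}$ described in the context. Assume a parametric scenario: at each sample size $n$ the true model is in $\Gamma$ and is denoted by $k_n^*$ (so $M_{k_n^*}f_n=f_n$), with $r_{k_n^*}>1$. Put $$A_n=\inf_{k\in S_1(k_n^* )}\|(I_n-M_k)f_n\|^2/\sigma^2 .$$ Assume: (P1) there exists $0<\tau\le\frac12$ such that $A_n$ is of order $n^{1/2+\tau}$ or higher (i.e. $\liminf_{n\to\infty}A_n/n^{1/2+\tau}>0$); (P2) $r_{k_n^*}\lambda_n\log(n)=o(n^{1/2+\tau})$, with the same $\tau$; (P3) $P(\hat k_n=k_n^* )\to1$ as $n\to\infty$. Then: (i) when $\sigma^2$ is known, the parametricness index $\mathrm{PI}_n$ (the known-$\sigma$ version) satisfies $\mathrm{PI}_n\stackrel{p}{\longrightarrow}\infty$ as $n\to\infty$; (ii) when $\sigma$ is unknown, with $\hat\sigma_n^2=\dfrac{\|\mathbf Y_n-\hat{\mathbf Y}_{\hat k_n}\|^2}{n-r_{\hat k_n}}$, the parametricness index $\mathrm{PI}_n$ (the estimated-$\sigma$ version with $\hat\sigma=\hat\sigma_n$) satisfies $\mathrm{PI}_n\stackrel{p}{\longrightarrow}\infty$ as $n\to\infty$.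
   Context: Regression model: $Y_i=f(x_i)+\varepsilon_i$, $i=1,\dots,n$, with fixed design points $x_i\in\mathbb R^p$, regression function $f$, and errors $\varepsilon_i$ independent $N(0,\sigma^2)$, $\sigma^2>0$. Write $\mathbf Y_n=(Y_1,\dots,Y_n)^T$, $f_n=(f(x_1),\dots,f(x_n))^T$, $I_n$ for the identity matrix and $\|\cdot\|$ for the Euclidean norm on $\mathbb R^n$. The true regression function may change with $n$. Candidate models: $\Gamma$ is the collection of indices $k$ of candidate models (it may change with $n$). Each model $k$ is a family of regression functions linear in a finite-dimensional parameter; $M_k$ is the orthogonal projection matrix onto the column space of its design matrix, $r_k=\mathrm{rank}(M_k)$, and $\hat{\mathbf Y}_k=M_k\mathbf Y_n$ is the least squares fit. For a model $k$, $S_1(k)$ is the set of all sub-models $k'$ of $k$ in $\Gamma$ (so the column space of $k'$ is contained in that of $k$) with $r_{k'}=r_k-1$. It is assumed throughout that $S_1(k)$ is nonempty for every $k\in\Gamma$ with $r_k>1$. Information criterion: for $\lambda_n\ge(\log n)^{-1}$ and a constant $d\ge0$, $$IC_{\lambda_n,d}(k)=\|\mathbf Y_n-\hat{\mathbf Y}_k\|^2+\lambda_n\log(n)r_k\sigma^2-n\sigma^2+d\,n^{1/2}\log(n)\sigma^2$$ when $\sigma$ is known, and $$IC_{\lambda_n,d}(k,\hat\sigma^2)=\|\mathbf Y_n-\hat{\mathbf Y}_k\|^2+\lambda_n\log(n)r_k\hat\sigma^2-n\hat\sigma^2+d\,n^{1/2}\log(n)\hat\sigma^2$$ when $\sigma$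 is estimated by $\hat\sigma$. Parametricness index: let $\hat k_n\in\Gamma$ be the model selected (from the data) at sample size $n$ by a given model selection method. For known $\sigma$, $$\mathrm{PI}_n=\inf_{k\in S_1(\hat k_n)}\frac{IC_{\lambda_n,d}(k)}{IC_{\lambda_n,d}(\hat k_n)}\ \text{ if } r_{\hat k_n}>1,\qquad \mathrm{PI}_n=n\ \text{ if } r_{\hat k_n}=1 .$$ For estimated $\sigma$, $$\mathrm{PI}_n=\inf_{k\in S_1(\hat k_n)}\frac{IC_{\lambda_n,d}(k,\hat\sigma^2)}{IC_{\lambda_n,d}(\hat k_n,\hat\sigma^2)}\ \text{ if } r_{\hat k_n}>1,\qquad \mathrm{PI}_n=n\ \text{ if } r_{\hat k_n}=1 .$$ $\mathrm{PI}_n\stackrel{p}{\longrightarrow}\infty$ means $P(\mathrm{PI}_n\ge M)\to1$ for every $M>0$.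
   Formalization: In (i) with d=0 the claim can fail (the criterion at the true model may be negative); there PI_n→∞ is proved if (λ_n log n −1)r_{k_n^*}/√n→∞, and |PI_n|→∞ always. Ratios of a positive number by 0 (possible in (ii) when d=0, λ_n log n=1) are read as ∞. *)

theory Defs
  imports
    "HOL-Probability.Probability"
    "HOL-Library.Landau_Symbols"
    "Jordan_Normal_Form.DL_Rank"
begin

text \<open>
  The sample size varies inside the statement, so the vectors and matrices of sample size \<open>n\<close> are
  those of the explicitly dimensioned types of Jordan\_Normal\_Form. Observations are indexed by
  \<open>0, \<dots>, n - 1\<close>. The parameter \<open>x\<close> below is the design at a fixed sample size, with values in an
  arbitrary type of regressors.
\<close>

definition euclid_norm :: "real Matrix.vec \<Rightarrow> real" where
  "euclid_norm v = sqrt (scalar_prod v v)"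

text \<open>
  A model that is linear in a finite-dimensional parameter is given by the list \<open>bs\<close> of its
  regressor functions. The functions need not be linearly independent.
\<close>

definition regression_family :: "('x \<Rightarrow> real) list \<Rightarrow> ('x \<Rightarrow> real) set" where
  "regression_family bs =
     {g. \<exists>\<theta>::nat \<Rightarrow> real. g = (\<lambda>t. \<Sum>j<length bs. \<theta> j * (bs ! j) t)}"

definition design_matrix :: "nat \<Rightarrow> (nat \<Rightarrow> 'x) \<Rightarrow> ('x \<Rightarrow> real) list \<Rightarrow> real mat" where
  "design_matrix n x bs = Matrix.mat n (length bs) (\<lambda>(i, j). (bs ! j) (x i))"

definition orth_proj_mat :: "nat \<Rightarrow> real Matrix.vec set \<Rightarrow> real mat" where
  "orth_proj_mat n W =
     (THE M. M \<in> carrier_mat n n \<and>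
        (\<forall>v\<in>carrier_vec n. M *\<^sub>v v \<in> W \<and> (\<forall>w\<in>W. scalar_prod (v - M *\<^sub>v v) w = 0)))"

definition proj_mat :: "nat \<Rightarrow> (nat \<Rightarrow> 'x) \<Rightarrow> ('x \<Rightarrow> real) list \<Rightarrow> real mat" where
  "proj_mat n x bs = orth_proj_mat n (vec_space.col_space n (design_matrix n x bs))"

definition model_rank :: "nat \<Rightarrow> (nat \<Rightarrow> 'x) \<Rightarrow> ('x \<Rightarrow> real) list \<Rightarrow> nat" where
  "model_rank n x bs = vec_space.rank n (proj_mat n x bs)"

definition mean_vec :: "nat \<Rightarrow> (nat \<Rightarrow> 'x) \<Rightarrow> ('x \<Rightarrow> real) \<Rightarrow> real Matrix.vec" where
  "mean_vec n x f = Matrix.vec n (\<lambda>i. f (x i))"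

definition response_vec ::
  "nat \<Rightarrow> (nat \<Rightarrow> 'x) \<Rightarrow> ('x \<Rightarrow> real) \<Rightarrow> (nat \<Rightarrow> real) \<Rightarrow> real Matrix.vec" where
  "response_vec n x f e = Matrix.vec n (\<lambda>i. f (x i) + e i)"

text \<open>
  \<open>B k\<close> is the list of regressors of the model with index \<open>k\<close>, and \<open>\<Gamma>\<close> the set of candidate indices.
\<close>

definition submodels1 ::
  "nat \<Rightarrow> (nat \<Rightarrow> 'x) \<Rightarrow> ('k \<Rightarrow> ('x \<Rightarrow> real) list) \<Rightarrow> 'k set \<Rightarrow> 'k \<Rightarrow> 'k set" where
  "submodels1 n x B \<Gamma> k =
     {k'\<in>\<Gamma>. regression_family (B k') \<subseteq> regression_family (B k) \<and>
            model_rank n x (B k') + 1 = model_rank n x (B k)}"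

definition rss :: "nat \<Rightarrow> (nat \<Rightarrow> 'x) \<Rightarrow> ('x \<Rightarrow> real) list \<Rightarrow> real Matrix.vec \<Rightarrow> real" where
  "rss n x bs y = (euclid_norm (y - proj_mat n x bs *\<^sub>v y))\<^sup>2"

definition sigma2_hat :: "nat \<Rightarrow> (nat \<Rightarrow> 'x) \<Rightarrow> ('x \<Rightarrow> real) list \<Rightarrow> real Matrix.vec \<Rightarrow> real" where
  "sigma2_hat n x bs y = rss n x bs y / (real n - real (model_rank n x bs))"

text \<open>In the next two definitions \<open>s2\<close> is the error variance or an estimate of it.\<close>

definition info_crit ::
  "nat \<Rightarrow> (nat \<Rightarrow> 'x) \<Rightarrow> real \<Rightarrow> real \<Rightarrow> real \<Rightarrow> real Matrix.vec \<Rightarrow> ('x \<Rightarrow> real) list \<Rightarrow> real" where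
  "info_crit n x lam d s2 y bs =
     rss n x bs y + lam * ln (real n) * real (model_rank n x bs) * s2 - real n * s2
       + d * sqrt (real n) * ln (real n) * s2"

text \<open>
  The infimum is taken in \<^typ>\<open>ereal\<close> because it may range over an infinite set of ratios. In that
  type a positive number divided by \<open>0\<close> is \<open>\<infinity>\<close>, which is the value of the ratio that is wanted when
  the criterion vanishes at the selected model. For known variance and \<open>d = 0\<close> the criterion at the
  selected model can be negative with probability bounded away from \<open>0\<close>. The index is then negative as
  well and tends to infinity only in absolute value.
\<close>

definition param_index ::
  "nat \<Rightarrow> (nat \<Rightarrow> 'x) \<Rightarrow> ('k \<Rightarrow> ('x \<Rightarrow> real) list) \<Rightarrow> 'k set \<Rightarrow> real \<Rightarrow> real \<Rightarrow> real
     \<Rightarrow> real Matrix.vec \<Rightarrow> 'k \<Rightarrow> ereal" where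
  "param_index n x B \<Gamma> lam d s2 y k =
     (if model_rank n x (B k) > 1
      then (INF k'\<in>submodels1 n x B \<Gamma> k.
              ereal (info_crit n x lam d s2 y (B k')) / ereal (info_crit n x lam d s2 y (B k)))
      else ereal (real n))"

definition signal_gap ::
  "nat \<Rightarrow> (nat \<Rightarrow> 'x) \<Rightarrow> ('k \<Rightarrow> ('x \<Rightarrow> real) list) \<Rightarrow> 'k set \<Rightarrow> ('x \<Rightarrow> real) \<Rightarrow> real \<Rightarrow> 'k \<Rightarrow> real" where
  "signal_gap n x B \<Gamma> f \<sigma> k =
     (INF k'\<in>submodels1 n x B \<Gamma> k.
        (euclid_norm ((1\<^sub>m n - proj_mat n x (B k')) *\<^sub>v mean_vec n x f))\<^sup>2 / \<sigma>\<^sup>2)"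

text \<open>
  No restriction is put on the cardinality of the candidate sets, so the event \<open>X n \<ge> C\<close> need not be
  measurable for an index that involves an infimum over sub-models. Its probability is therefore read
  as an inner probability. The lemma below shows that this is the usual notion for measurable events.
\<close>

definition tends_to_infinity_in_prob :: "'a measure \<Rightarrow> (nat \<Rightarrow> 'a \<Rightarrow> ereal) \<Rightarrow> bool" where
  "tends_to_infinity_in_prob P X \<longleftrightarrow>
     (\<forall>C::real. C > 0 \<longrightarrow>
        (\<exists>E. (\<forall>n. E n \<in> sets P \<and> E n \<subseteq> {\<omega>\<in>space P. X n \<omega> \<ge> ereal C}) \<and>
             (\<lambda>n. measure P (E n)) \<longlonglongrightarrow> 1))"

lemma tends_to_infinity_in_prob_iff:
  assumes "prob_space P"
    and meas: "\<And>n C. {\<omega>\<in>space P. X n \<omega> \<ge> ereal C} \<in> sets P"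
  shows "tends_to_infinity_in_prob P X \<longleftrightarrow>
     (\<forall>C::real. C > 0 \<longrightarrow> (\<lambda>n. measure P {\<omega>\<in>space P. X n \<omega> \<ge> ereal C}) \<longlonglongrightarrow> 1)"
proof -
  interpret prob_space P by fact
  have "(\<lambda>n. prob {\<omega>\<in>space P. X n \<omega> \<ge> ereal C}) \<longlonglongrightarrow> 1"
    if E: "\<And>n. E n \<in> sets P" "\<And>n. E n \<subseteq> {\<omega>\<in>space P. X n \<omega> \<ge> ereal C}"
      and lim: "(\<lambda>n. prob (E n)) \<longlonglongrightarrow> 1" for E C
  proof (rule tendsto_sandwich[OF _ _ lim tendsto_const])
    show "\<forall>\<^sub>F n in sequentially. prob (E n) \<le> prob {\<omega>\<in>space P. X n \<omega> \<ge> ereal C}"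
      using E meas by (intro always_eventually allI finite_measure_mono) auto
  qed simp
  note minorant = this
  show ?thesis
    unfolding tends_to_infinity_in_prob_def
  proof (intro iffI allI impI, goal_cases)
    case (1 C)
    then obtain E where "\<forall>n. E n \<in> sets P \<and> E n \<subseteq> {\<omega>\<in>space P. X n \<omega> \<ge> ereal C}"
      and "(\<lambda>n. prob (E n)) \<longlonglongrightarrow> 1"
      by metis
    then show ?case by (intro minorant) simp_all
  next
    case (2 C)
    then show ?case
      using meas by (intro exI[of _ "\<lambda>n. {\<omega>\<in>space P. X n \<omega> \<ge> ereal C}"]) simp
  qed
qed

end

theory Submission
  imports Defs "HOL-Real_Asymp.Real_Asymp"
begin

text \<open>
  On the event that the true model \<open>k*\<close> is selected, every \<open>k \<in> S\<^sub>1(k*)\<close> has nested projections, so with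
  \<open>Q = \<parallel>M\<^bsub>k*\<^esub> \<epsilon>\<parallel>\<^sup>2\<close> one has, simultaneously for all \<open>k\<close>,
  \<open>RSS(k) - RSS(k*) = \<parallel>(M\<^bsub>k*\<^esub> - M\<^sub>k) Y\<parallel>\<^sup>2 \<ge> \<parallel>(I - M\<^sub>k) f\<parallel>\<^sup>2 / 2 - Q\<close>. This needs no union bound over the
  possibly infinite set of sub-models. The variance of a quadratic form with symmetric idempotent matrix
  is \<open>2 \<sigma>\<^sup>4\<close> times its trace, so by Chebyshev both \<open>\<parallel>\<epsilon>\<parallel>\<^sup>2\<close> and \<open>Q\<close> deviate from \<open>n \<sigma>\<^sup>2\<close> and
  \<open>r \<sigma>\<^sup>2\<close> by at most \<open>a n\<^sup>1\<^sup>/\<^sup>2 \<sigma>\<^sup>2\<close>, where \<open>a\<close> tends to infinity arbitrarily slowly. Hence the criterion at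
  \<open>k*\<close> is \<open>o(n\<^sup>1\<^sup>/\<^sup>2\<^sup>+\<^sup>\<tau>)\<close>, while at every \<open>k\<close> it is at least a constant times \<open>n\<^sup>1\<^sup>/\<^sup>2\<^sup>+\<^sup>\<tau>\<close>.
\<close>

unbundle no vec_syntax

section \<open>Orthogonal projections\<close>

abbreviation lspan :: "nat \<Rightarrow> real Matrix.vec set \<Rightarrow> real Matrix.vec set" where
  "lspan n \<equiv> LinearCombinations.module.span class_ring (module_vec TYPE(real) n)"

text \<open>The property under the description operator in \<open>orth_proj_mat\<close>, isolated so
  that existence and uniqueness can be proved before that operator is evaluated.\<close>

definition is_orth_proj :: "nat \<Rightarrow> real Matrix.vec set \<Rightarrow> real mat \<Rightarrow> bool" where
  "is_orth_proj n W M \<longleftrightarrow> M \<in> carrier_mat n n \<and>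
     (\<forall>v\<in>carrier_vec n. M *\<^sub>v v \<in> W \<and> (\<forall>w\<in>W. scalar_prod (v - M *\<^sub>v v) w = 0))"

text \<open>Expectation and variance of the noise forms come out as traces; the comparison with the
  rank in the penalty then goes through trace \<le> rank.\<close>

definition mat_trace :: "real mat \<Rightarrow> real" where
  "mat_trace M = (\<Sum>i<dim_row M. M $$ (i, i))"

text \<open>Reduces orthogonality to a whole span to a check on generators, which is how the
  Gram-Schmidt step is verified.\<close>

lemma scalar_prod_lspan_eq_0:
  assumes S: "S \<subseteq> carrier_vec n" and v: "v \<in> carrier_vec n"
    and orth: "\<And>w. w \<in> S \<Longrightarrow> scalar_prod v w = 0" and w: "w \<in> lspan n S"
  shows "scalar_prod v w = 0"
proof -
  interpret vec_space "TYPE(real)" n .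
  have "v \<in> orthogonal_complement S"
    using v orth by (auto simp: orthogonal_complement_def)
  then have "v \<in> orthogonal_complement (span S)"
    using in_orthogonal_complement_span[OF S] by auto
  with w show ?thesis by (auto simp: orthogonal_complement_def)
qed

lemma scalar_prod_self_eq_0_iff:
  fixes v :: "real Matrix.vec"
  assumes v: "v \<in> carrier_vec n"
  shows "scalar_prod v v = 0 \<longleftrightarrow> v = 0\<^sub>v n"
proof
  assume "scalar_prod v v = 0"
  then have "(\<Sum>i\<in>{0..<n}. v $ i * v $ i) = 0"
    using v by (simp add: scalar_prod_def)
  then have "v $ i = 0" if "i < n" for i
    using that by (subst (asm) sum_nonneg_eq_0_iff) auto
  then show "v = 0\<^sub>v n" using v by (intro eq_vecI) auto
qed auto

lemma
  fixes a b c :: "real Matrix.vec"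
  assumes "a \<in> carrier_vec n" "b \<in> carrier_vec n" "c \<in> carrier_vec n"
  shows vec_diff_add_cancel: "a = (a - b) + b"
    and vec_add_uminus_smult: "a + (-1) \<cdot>\<^sub>v b = a - b"
    and vec_diff_add: "a - (b + c) = (a - b) - c"
    and vec_diff_diff: "a - b = (c - b) - (c - a)"
  using assms by (auto intro!: eq_vecI)

lemma vec_diff_eq_0D:
  fixes a b :: "real Matrix.vec"
  assumes "a - b = 0\<^sub>v n" "a \<in> carrier_vec n" "b \<in> carrier_vec n"
  shows "a = b"
proof -
  have "a = 0\<^sub>v n + b"
    using vec_diff_add_cancel[OF assms(2,3,3)] assms(1) by simp
  then show ?thesis using assms(3) by simp
qed

lemma mult_rank_one_update:
  fixes M :: "real mat"
  assumes M: "M \<in> carrier_mat n n" and u: "u \<in> carrier_vec n" and v: "v \<in> carrier_vec n"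
  shows "Matrix.mat n n (\<lambda>(i, j). M $$ (i, j) + c * (u $ i * u $ j)) *\<^sub>v v
           = M *\<^sub>v v + (c * scalar_prod u v) \<cdot>\<^sub>v u"
proof (rule eq_vecI)
  fix i assume "i < dim_vec (M *\<^sub>v v + (c * scalar_prod u v) \<cdot>\<^sub>v u)"
  then have i: "i < n" using u by simp
  show "(Matrix.mat n n (\<lambda>(i, j). M $$ (i, j) + c * (u $ i * u $ j)) *\<^sub>v v) $ i
      = (M *\<^sub>v v + (c * scalar_prod u v) \<cdot>\<^sub>v u) $ i"
    using i M u v
    by (simp add: scalar_prod_def sum.distrib distrib_right distrib_left sum_distrib_left mult_ac)
qed (use M u in auto)

lemma zero_mat_mult_vec:
  fixes v :: "real Matrix.vec"
  assumes "v \<in> carrier_vec n"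
  shows "0\<^sub>m n n *\<^sub>v v = 0\<^sub>v n"
  using assms by (intro eq_vecI) auto

text \<open>
  Gram-Schmidt as a rank-one update: each new vector adds the projection onto its residual \<open>u\<close>, and at
  most \<open>1\<close> to the trace. Dependent vectors have \<open>u = 0\<close> and contribute nothing.
\<close>

lemma ex_orth_proj_lspan:
  assumes "set us \<subseteq> carrier_vec n"
  shows "\<exists>M. is_orth_proj n (lspan n (set us)) M \<and> mat_trace M \<le> real (length us)"
  using assms
proof (induction us)
  case Nil
  interpret vec_space "TYPE(real)" n .
  have "span {} = {0\<^sub>v n}" using span_empty by simp
  then have "is_orth_proj n (lspan n {}) (0\<^sub>m n n)"
    unfolding is_orth_proj_def
    by (simp add: zero_mat_mult_vec scalar_prod_right_zero[OF carrier_vecI])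
  then show ?case by (intro exI[of _ "0\<^sub>m n n"]) (simp add: mat_trace_def)
next
  case (Cons b us)
  interpret vec_space "TYPE(real)" n .
  let ?S = "set us"
  have S: "?S \<subseteq> carrier_vec n" and b: "b \<in> carrier_vec n" using Cons.prems by auto
  obtain M where M: "is_orth_proj n (span ?S) M" and tr: "mat_trace M \<le> real (length us)"
    using Cons.IH S by auto
  have Mc: "M \<in> carrier_mat n n" and Mv: "\<And>v. v \<in> carrier_vec n \<Longrightarrow> M *\<^sub>v v \<in> span ?S"
    and orth: "\<And>v w. v \<in> carrier_vec n \<Longrightarrow> w \<in> span ?S \<Longrightarrow> scalar_prod (v - M *\<^sub>v v) w = 0"
    using M unfolding is_orth_proj_def by blast+
  have Mvc: "M *\<^sub>v v \<in> carrier_vec n" for v using Mc by (intro carrier_vecI) auto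
  define u where "u = b - M *\<^sub>v b"
  have u: "u \<in> carrier_vec n" using b Mvc by (simp add: u_def)
  have bu: "b = u + M *\<^sub>v b" unfolding u_def by (rule vec_diff_add_cancel[OF b Mvc b])
  define c where "c = (if scalar_prod u u = 0 then 0 else 1 / scalar_prod u u)"
  define M' where "M' = Matrix.mat n n (\<lambda>(i, j). M $$ (i, j) + c * (u $ i * u $ j))"
  have u0: "u = 0\<^sub>v n" if "scalar_prod u u = 0"
    using that u by (simp add: scalar_prod_self_eq_0_iff)
  have M'v: "M' *\<^sub>v v = M *\<^sub>v v + (c * scalar_prod u v) \<cdot>\<^sub>v u" if "v \<in> carrier_vec n" for v
    unfolding M'_def using mult_rank_one_update[OF Mc u that] .
  have sub: "span ?S \<subseteq> span (insert b ?S)" by (intro span_is_monotone) auto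
  have ins: "insert b ?S \<subseteq> carrier_vec n" using S b by auto
  have "b \<in> span (insert b ?S)" by (rule subsetD[OF in_own_span[OF ins]]) simp
  then have u_span: "u \<in> span (insert b ?S)"
  proof -
    have "(-1) \<cdot>\<^sub>v (M *\<^sub>v b) \<in> span (insert b ?S)"
      by (rule smult_in_span[OF ins subsetD[OF sub Mv[OF b]]])
    with \<open>b \<in> span (insert b ?S)\<close> have "b + (-1) \<cdot>\<^sub>v (M *\<^sub>v b) \<in> span (insert b ?S)"
      using span_add1[OF ins] by simp
    moreover have "b + (-1) \<cdot>\<^sub>v (M *\<^sub>v b) = u"
      unfolding u_def by (rule vec_add_uminus_smult[OF b Mvc b])
    ultimately show ?thesis by simp
  qed
  have "is_orth_proj n (span (insert b ?S)) M'"
    unfolding is_orth_proj_def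
  proof (intro conjI ballI)
    show "M' \<in> carrier_mat n n" by (simp add: M'_def)
  next
    fix v :: "real Matrix.vec" assume v: "v \<in> carrier_vec n"
    show "M' *\<^sub>v v \<in> span (insert b ?S)"
      unfolding M'v[OF v]
      using span_add1[OF ins subsetD[OF sub Mv[OF v]] smult_in_span[OF ins u_span]] by simp
    have diff: "v - M' *\<^sub>v v = (v - M *\<^sub>v v) - (c * scalar_prod u v) \<cdot>\<^sub>v u"
      unfolding M'v[OF v] using u by (intro vec_diff_add[OF v Mvc]) simp
    have sp: "scalar_prod (v - M' *\<^sub>v v) w
        = scalar_prod (v - M *\<^sub>v v) w - c * scalar_prod u v * scalar_prod u w"
      if "w \<in> carrier_vec n" for w
      unfolding diff using v u Mvc[of v] that
      by (subst minus_scalar_prod_distrib[of _ n]) auto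
    fix w assume w: "w \<in> span (insert b ?S)"
    show "scalar_prod (v - M' *\<^sub>v v) w = 0"
    proof (rule scalar_prod_lspan_eq_0[OF ins _ _ w])
      show "v - M' *\<^sub>v v \<in> carrier_vec n"
        unfolding diff using v u Mvc by auto
    next
      fix w assume "w \<in> insert b ?S"
      then consider "w = b" | "w \<in> ?S" by blast
      then show "scalar_prod (v - M' *\<^sub>v v) w = 0"
      proof cases
        case 1
        \<comment> \<open>For the new generator, write \<open>b\<close> as \<open>u + M b\<close>.
          The part \<open>M b\<close> lies in the old span and is orthogonal to every residual, so
          only inner products with \<open>u\<close> survive, and these cancel by the choice of
          \<open>c\<close>.\<close>
        have split: "scalar_prod y b = scalar_prod y u + scalar_prod y (M *\<^sub>v b)"
          if "y \<in> carrier_vec n" for y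
          by (rule trans[OF arg_cong[OF bu, of "scalar_prod y"] scalar_prod_add_distrib[OF that u Mvc]])
        have ub: "scalar_prod u b = scalar_prod u u"
          using split[OF u] orth[OF b Mv[OF b]] by (simp add: u_def)
        have "scalar_prod (v - M *\<^sub>v v) b = scalar_prod (v - M *\<^sub>v v) u"
          using split[of "v - M *\<^sub>v v"] orth[OF v Mv[OF b]] v Mvc[of v] by simp
        also have "\<dots> = scalar_prod v u - scalar_prod (M *\<^sub>v v) u"
          using u v Mvc by (subst minus_scalar_prod_distrib[of _ n]) auto
        also have "scalar_prod (M *\<^sub>v v) u = scalar_prod u (M *\<^sub>v v)"
          using u Mvc by (intro comm_scalar_prod) auto
        also have "scalar_prod u (M *\<^sub>v v) = 0"
          unfolding u_def using orth[OF b Mv[OF v]] .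
        also have "scalar_prod v u = scalar_prod u v"
          using u v by (intro comm_scalar_prod) auto
        finally have "scalar_prod (v - M *\<^sub>v v) b = scalar_prod u v" by simp
        then show ?thesis
          unfolding 1 sp[OF b] ub using u0 v by (auto simp: c_def)
      next
        case 2
        then have "w \<in> span ?S" "w \<in> carrier_vec n"
          using subsetD[OF in_own_span[OF S]] subsetD[OF S] by simp_all
        then show ?thesis using sp[of w] orth[OF v, of w] orth[OF b, of w] by (simp add: u_def)
      qed
    qed
  qed
  moreover have "mat_trace M' \<le> real (length (b # us))"
  proof -
    have "mat_trace M' = mat_trace M + c * scalar_prod u u"
      using Mc u by (simp add: mat_trace_def M'_def sum.distrib scalar_prod_def sum_distrib_left
          lessThan_atLeast0)
    then show ?thesis using tr by (auto simp: c_def)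
  qed
  ultimately show ?case by (intro exI[of _ M']) simp
qed

section \<open>Uniqueness, symmetry, trace and rank of an orthogonal projection\<close>

locale orth_proj =
  fixes n :: nat and W :: "real Matrix.vec set" and M :: "real mat"
  assumes proj: "is_orth_proj n W M"
    and W_carrier: "W \<subseteq> carrier_vec n"
    and W_diff: "\<And>v w. v \<in> W \<Longrightarrow> w \<in> W \<Longrightarrow> v - w \<in> W"
begin

lemma M_carrier [simp]: "M \<in> carrier_mat n n"
  and M_in: "v \<in> carrier_vec n \<Longrightarrow> M *\<^sub>v v \<in> W"
  and M_orth: "v \<in> carrier_vec n \<Longrightarrow> w \<in> W \<Longrightarrow> scalar_prod (v - M *\<^sub>v v) w = 0"
  using proj unfolding is_orth_proj_def by blast+

lemma M_dim [simp]: "dim_row M = n" "dim_col M = n"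
  using carrier_matD[OF M_carrier] by simp_all

lemma M_vec_carrier [simp]: "M *\<^sub>v v \<in> carrier_vec n"
  by (intro carrier_vecI) simp

lemma W_D: "w \<in> W \<Longrightarrow> w \<in> carrier_vec n"
  using W_carrier by blast

text \<open>The difference of the two candidates lies in \<open>W\<close> by closure under
  differences and is orthogonal to all of \<open>W\<close>, hence to itself, so it vanishes.\<close>

lemma proj_eqI:
  assumes v: "v \<in> carrier_vec n" and p: "p \<in> W" and orth: "\<And>w. w \<in> W \<Longrightarrow> scalar_prod (v - p) w = 0"
  shows "M *\<^sub>v v = p"
proof -
  let ?z = "M *\<^sub>v v - p"
  have z: "?z \<in> W" using W_diff M_in v p by blast
  have pc: "p \<in> carrier_vec n" using p W_D by blast
  have "?z = (v - p) - (v - M *\<^sub>v v)"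
    by (rule vec_diff_diff[OF M_vec_carrier pc v])
  then have "scalar_prod ?z ?z = scalar_prod ((v - p) - (v - M *\<^sub>v v)) ?z"
    by (rule arg_cong)
  also have "\<dots> = scalar_prod (v - p) ?z - scalar_prod (v - M *\<^sub>v v) ?z"
    by (rule minus_scalar_prod_distrib[of _ n]) (use v pc in simp_all)
  also have "\<dots> = 0" using orth[OF z] M_orth[OF v z] by simp
  finally have z0: "?z = 0\<^sub>v n"
    using pc scalar_prod_self_eq_0_iff[of ?z n] by simp
  then show ?thesis by (rule vec_diff_eq_0D) (use pc in simp_all)
qed

lemma proj_fix:
  assumes w: "w \<in> W"
  shows "M *\<^sub>v w = w"
proof (rule proj_eqI[OF W_D[OF w] w])
  fix z assume "z \<in> W"
  have "w - w = 0\<^sub>v n" by (rule minus_cancel_vec[OF W_D[OF w]])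
  then show "scalar_prod (w - w) z = 0"
    using scalar_prod_left_zero[OF W_D[OF \<open>z \<in> W\<close>]] by metis
qed

lemma unit_entry: "i < n \<Longrightarrow> j < n \<Longrightarrow> (M *\<^sub>v unit_vec n j) $ i = M $$ (i, j)"
  by simp

lemma proj_unique:
  assumes N: "is_orth_proj n W N"
  shows "N = M"
proof (rule eq_matI)
  have Nc: "N \<in> carrier_mat n n"
    and N_in: "\<And>v. v \<in> carrier_vec n \<Longrightarrow> N *\<^sub>v v \<in> W"
    and N_orth: "\<And>v w. v \<in> carrier_vec n \<Longrightarrow> w \<in> W \<Longrightarrow> scalar_prod (v - N *\<^sub>v v) w = 0"
    using N unfolding is_orth_proj_def by blast+
  show dim: "dim_row N = dim_row M" "dim_col N = dim_col M" using carrier_matD[OF Nc] by simp_all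
  fix i j assume "i < dim_row M" "j < dim_col M"
  then have ij: "i < n" "j < n" by simp_all
  have "M *\<^sub>v unit_vec n j = N *\<^sub>v unit_vec n j"
    by (rule proj_eqI[OF _ N_in N_orth]) simp_all
  then show "N $$ (i, j) = M $$ (i, j)"
    using unit_entry[OF ij] ij carrier_matD[OF Nc] by simp
qed

lemma orth_proj_mat_eq: "orth_proj_mat n W = M"
  unfolding orth_proj_mat_def is_orth_proj_def[symmetric]
  using proj proj_unique by (rule the_equality)

lemma scalar_prod_proj:
  assumes "v \<in> carrier_vec n" "w \<in> W"
  shows "scalar_prod (M *\<^sub>v v) w = scalar_prod v w"
  using M_orth[OF assms] minus_scalar_prod_distrib[OF assms(1) M_vec_carrier W_D[OF assms(2)], of v] by simp

lemma scalar_prod_proj_proj: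
  assumes "v \<in> carrier_vec n" "w \<in> carrier_vec n"
  shows "scalar_prod (M *\<^sub>v v) (M *\<^sub>v w) = scalar_prod v (M *\<^sub>v w)"
  using scalar_prod_proj[OF assms(1) M_in[OF assms(2)]] .

text \<open>By self-adjointness each entry is the inner product of the images of two unit vectors,
  and that product is commutative.\<close>

lemma proj_symmetric:
  assumes "i < n" "j < n"
  shows "M $$ (i, j) = M $$ (j, i)"
proof -
  have "scalar_prod (M *\<^sub>v unit_vec n i) (M *\<^sub>v unit_vec n j) = M $$ (i, j)"
    by (subst scalar_prod_proj_proj) (use assms unit_entry in auto)
  moreover have "scalar_prod (M *\<^sub>v unit_vec n j) (M *\<^sub>v unit_vec n i) = M $$ (j, i)"
    by (subst scalar_prod_proj_proj) (use assms unit_entry in auto)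
  ultimately show ?thesis
    using comm_scalar_prod[of "M *\<^sub>v unit_vec n i" n "M *\<^sub>v unit_vec n j"] by simp
qed

text \<open>The diagonal of \<open>M = M^T M\<close>. Summed over \<open>i\<close>, it turns the sum
  of squared entries in the variance into the trace; for a single \<open>i\<close>, it forces the
  diagonal entry to be at most 1.\<close>

lemma diag_eq_sum_squares:
  assumes "i < n"
  shows "M $$ (i, i) = (\<Sum>j<n. (M $$ (i, j))\<^sup>2)"
proof -
  have "M $$ (i, i) = scalar_prod (unit_vec n i) (M *\<^sub>v unit_vec n i)"
    using unit_entry[of i i] assms by simp
  also have "\<dots> = scalar_prod (M *\<^sub>v unit_vec n i) (M *\<^sub>v unit_vec n i)"
    by (subst scalar_prod_proj_proj) auto
  also have "\<dots> = (\<Sum>j<n. ((M *\<^sub>v unit_vec n i) $ j)\<^sup>2)"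
    by (simp add: scalar_prod_def power2_eq_square lessThan_atLeast0)
  also have "\<dots> = (\<Sum>j<n. (M $$ (j, i))\<^sup>2)"
    using unit_entry assms by (intro sum.cong) simp_all
  finally show ?thesis using assms proj_symmetric by simp
qed

lemma mat_trace_eq: "mat_trace M = (\<Sum>i<n. M $$ (i, i))"
  using M_carrier by (simp add: mat_trace_def)

lemma sum_squares_eq_trace: "(\<Sum>i<n. \<Sum>j<n. (M $$ (i, j))\<^sup>2) = mat_trace M"
  using diag_eq_sum_squares by (simp add: mat_trace_eq)

lemma mat_trace_le: "mat_trace M \<le> real n"
proof -
  have "M $$ (i, i) \<le> 1" if "i < n" for i
  proof -
    have "(M $$ (i, i))\<^sup>2 \<le> (\<Sum>j<n. (M $$ (i, j))\<^sup>2)"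
      using that by (intro member_le_sum) auto
    then have "(M $$ (i, i))\<^sup>2 \<le> M $$ (i, i)" using diag_eq_sum_squares[OF that] by simp
    then show ?thesis
      using mult_le_cancel_left_pos[of "M $$ (i, i)" "M $$ (i, i)" 1]
      by (cases "0 < M $$ (i, i)") (auto simp: power2_eq_square)
  qed
  then have "(\<Sum>i<n. M $$ (i, i)) \<le> (\<Sum>i<n. 1)" by (intro sum_mono) auto
  then show ?thesis by (simp add: mat_trace_eq)
qed

lemma norm_proj_eq_quadratic_form:
  assumes v: "v \<in> carrier_vec n"
  shows "scalar_prod (M *\<^sub>v v) (M *\<^sub>v v) = (\<Sum>i<n. \<Sum>j<n. M $$ (i, j) * (v $ i * v $ j))"
proof -
  have "scalar_prod (M *\<^sub>v v) (M *\<^sub>v v) = scalar_prod v (M *\<^sub>v v)"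
    using scalar_prod_proj_proj v by blast
  also have "\<dots> = (\<Sum>i<n. \<Sum>j<n. M $$ (i, j) * (v $ i * v $ j))"
    using v
    by (simp add: scalar_prod_def lessThan_atLeast0 sum_distrib_left mult_ac)
  finally show ?thesis .
qed

lemma pythagoras:
  assumes v: "v \<in> carrier_vec n"
  shows "scalar_prod v v
    = scalar_prod (v - M *\<^sub>v v) (v - M *\<^sub>v v) + scalar_prod (M *\<^sub>v v) (M *\<^sub>v v)"
  using scalar_prod_proj_proj[OF v v] v comm_scalar_prod[of "M *\<^sub>v v" n v]
  by (simp add: minus_scalar_prod_distrib[of _ n] scalar_prod_minus_distrib[of _ n])

text \<open>The rank of \<open>M\<close> speaks about the columns of \<open>M\<close>, the
  projection about \<open>W\<close>. This link lets a maximal independent set of columns serve as a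
  spanning set of \<open>W\<close>.\<close>

lemma col_space_eq_W: "vec_space.col_space n M = W"
proof -
  interpret vec_space "TYPE(real)" n .
  have "col_space M = {y \<in> carrier_vec n. \<exists>x\<in>carrier_vec n. M *\<^sub>v x = y}"
    using col_space_eq[OF M_carrier] M_carrier by simp
  also have "\<dots> = W"
    using M_in proj_fix W_D by fastforce
  finally show ?thesis .
qed

text \<open>
  Applied to a basis of the column space, the trace bound of \<open>ex_orth_proj_lspan\<close> passes to \<open>M\<close> by uniqueness.
\<close>

lemma mat_trace_le_rank: "mat_trace M \<le> real (vec_space.rank n M)"
proof -
  interpret vec_space "TYPE(real)" n .
  have cols: "set (cols M) \<subseteq> carrier_vec n" using cols_dim M_carrier by (metis carrier_matD(1))
  obtain S where mx: "maximal S (\<lambda>T. T \<subseteq> set (cols M) \<and> lin_indpt T)" and fin: "finite S"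
    using maximal_exists_superset[of "set (cols M)" "\<lambda>T. T \<subseteq> set (cols M) \<and> lin_indpt T" "{}"]
      finite_lin_indpt2[of "{}"] by auto
  have S: "S \<subseteq> set (cols M)" "lin_indpt S" using mx by (auto simp: maximal_def)
  have Sc: "S \<subseteq> carrier_vec n" using S cols by auto
  have "set (cols M) \<subseteq> span S"
  proof (rule ccontr)
    assume "\<not> set (cols M) \<subseteq> span S"
    then obtain c where c: "c \<in> set (cols M)" "c \<notin> span S" by blast
    then have cS: "c \<notin> S" and cV: "c \<in> carrier_vec n"
      using subsetD[OF in_own_span[OF Sc]] cols by blast+
    then have "lin_indpt (S \<union> {c})"
      using lin_dep_iff_in_span[of S c] Sc S(2) c(2) by simp
    with mx c S(1) cS show False unfolding maximal_def by blast
  qed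
  then have "span (set (cols M)) \<subseteq> span S" using span_subsetI[OF Sc] by blast
  moreover have "span S \<subseteq> span (set (cols M))" using S by (intro span_is_monotone) auto
  ultimately have W: "span S = W" using col_space_eq_W by (simp add: col_space_def)
  obtain us where us: "set us = S" "distinct us" using finite_distinct_list[OF fin] by blast
  obtain N where N: "is_orth_proj n (span S) N" "mat_trace N \<le> real (length us)"
    using ex_orth_proj_lspan[of us n] us Sc by auto
  have "length us = rank M"
    using rank_card_indpt[OF M_carrier mx] us distinct_card by fastforce
  then show ?thesis using N proj_unique W by auto
qed

end

section \<open>Residual sums of squares\<close>

lemma mean_vec_carrier [simp]: "mean_vec n x f \<in> carrier_vec n"
  by (simp add: mean_vec_def)

lemma design_matrix_carrier: "design_matrix n x bs \<in> carrier_mat n (length bs)"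
  by (simp add: design_matrix_def)

lemma design_matrix_mult_vec:
  "design_matrix n x bs *\<^sub>v Matrix.vec (length bs) \<theta>
     = mean_vec n x (\<lambda>t. \<Sum>j<length bs. \<theta> j * (bs ! j) t)"
  by (rule eq_vecI)
    (simp_all add: design_matrix_def mean_vec_def scalar_prod_def lessThan_atLeast0 mult.commute)

text \<open>Removes the parameter vectors: nesting of regression families becomes plain inclusion of
  model spaces, even when the two models have unrelated lists of regressors.\<close>

lemma col_space_design_matrix:
  "vec_space.col_space n (design_matrix n x bs) = mean_vec n x ` regression_family bs"
proof -
  interpret vec_space "TYPE(real)" n .
  have dims: "dim_row (design_matrix n x bs) = n" "dim_col (design_matrix n x bs) = length bs"
    using carrier_matD[OF design_matrix_carrier[of n x bs]] by simp_all
  have "col_space (design_matrix n x bs)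
      = {y \<in> carrier_vec n. \<exists>v\<in>carrier_vec (length bs). design_matrix n x bs *\<^sub>v v = y}"
    by (simp only: col_space_eq[OF design_matrix_carrier] dims)
  also have "\<dots> = mean_vec n x ` regression_family bs"
  proof (intro equalityI subsetI)
    fix y assume "y \<in> {y \<in> carrier_vec n. \<exists>v\<in>carrier_vec (length bs). design_matrix n x bs *\<^sub>v v = y}"
    then obtain v where v: "v \<in> carrier_vec (length bs)" "y = design_matrix n x bs *\<^sub>v v" by blast
    have "v = Matrix.vec (length bs) (\<lambda>j. v $ j)" using v(1) by (intro eq_vecI) simp_all
    then have "y = mean_vec n x (\<lambda>t. \<Sum>j<length bs. v $ j * (bs ! j) t)"
      using v(2) design_matrix_mult_vec by metis
    then show "y \<in> mean_vec n x ` regression_family bs"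
      by (auto simp: regression_family_def)
  next
    fix y assume "y \<in> mean_vec n x ` regression_family bs"
    then obtain \<theta> where "y = mean_vec n x (\<lambda>t. \<Sum>j<length bs. \<theta> j * (bs ! j) t)"
      by (auto simp: regression_family_def)
    then have "y = design_matrix n x bs *\<^sub>v Matrix.vec (length bs) \<theta>"
      by (simp add: design_matrix_mult_vec)
    moreover from this have "y \<in> carrier_vec n" using dims by (intro carrier_vecI) simp
    ultimately show "y \<in> {y \<in> carrier_vec n. \<exists>v\<in>carrier_vec (length bs). design_matrix n x bs *\<^sub>v v = y}"
      using vec_carrier by blast
  qed
  finally show ?thesis .
qed

abbreviation model_space :: "nat \<Rightarrow> (nat \<Rightarrow> 'x) \<Rightarrow> ('x \<Rightarrow> real) list \<Rightarrow> real Matrix.vec set" where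
  "model_space n x bs \<equiv> mean_vec n x ` regression_family bs"

lemma regression_family_diff:
  assumes "g \<in> regression_family bs" "h \<in> regression_family bs"
  shows "(\<lambda>t. g t - h t) \<in> regression_family bs"
proof -
  obtain \<theta> \<eta> where "g = (\<lambda>t. \<Sum>j<length bs. \<theta> j * (bs ! j) t)"
    "h = (\<lambda>t. \<Sum>j<length bs. \<eta> j * (bs ! j) t)"
    using assms by (auto simp: regression_family_def)
  then have "(\<lambda>t. g t - h t) = (\<lambda>t. \<Sum>j<length bs. (\<theta> j - \<eta> j) * (bs ! j) t)"
    by (simp add: left_diff_distrib sum_subtractf)
  then show ?thesis by (auto simp: regression_family_def)
qed

lemma model_space_diff:
  assumes "v \<in> model_space n x bs" "w \<in> model_space n x bs"
  shows "v - w \<in> model_space n x bs"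
proof -
  obtain g h where gh: "g \<in> regression_family bs" "h \<in> regression_family bs"
    "v = mean_vec n x g" "w = mean_vec n x h" using assms by blast
  have "v - w = mean_vec n x (\<lambda>t. g t - h t)"
    unfolding gh by (rule eq_vecI) (simp_all add: mean_vec_def)
  then show ?thesis using regression_family_diff[OF gh(1,2)] by blast
qed

text \<open>Gram-Schmidt on the columns of the design matrix, dependent or not, yields some
  projection onto the model space; uniqueness identifies it with \<open>proj_mat\<close>.\<close>

lemma orth_proj_proj_mat: "orth_proj n (model_space n x bs) (proj_mat n x bs)"
proof -
  interpret vec_space "TYPE(real)" n .
  let ?W = "model_space n x bs" and ?us = "cols (design_matrix n x bs)"
  have us: "set ?us \<subseteq> carrier_vec n"
    using cols_dim[of "design_matrix n x bs"] carrier_matD(1)[OF design_matrix_carrier[of n x bs]]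
    by simp
  have W: "span (set ?us) = ?W"
    using col_space_design_matrix[of n x bs] by (simp add: col_space_def)
  obtain M where M: "is_orth_proj n ?W M"
    using ex_orth_proj_lspan[OF us] unfolding W by blast
  have c: "?W \<subseteq> carrier_vec n" by (rule image_subsetI) (rule mean_vec_carrier)
  have op: "orth_proj n ?W M"
    by (rule orth_proj.intro[OF M c model_space_diff])
  have "proj_mat n x bs = orth_proj_mat n ?W"
    by (simp only: proj_mat_def col_space_design_matrix)
  also have "\<dots> = M" by (rule orth_proj.orth_proj_mat_eq[OF op])
  finally show ?thesis using op by (simp only:)
qed

section \<open>Decomposition of residual sums of squares\<close>

lemma scalar_prod_self_nonneg: "0 \<le> scalar_prod v (v :: real Matrix.vec)"
  by (simp add: scalar_prod_def sum_nonneg)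

lemma euclid_norm_sq: "(euclid_norm v)\<^sup>2 = scalar_prod v v"
  by (simp add: euclid_norm_def scalar_prod_self_nonneg)

lemma
  fixes a b :: "real Matrix.vec"
  assumes "a \<in> carrier_vec n" "b \<in> carrier_vec n"
  shows scalar_prod_add_self:
      "scalar_prod (a + b) (a + b) = scalar_prod a a + 2 * scalar_prod a b + scalar_prod b b"
    and scalar_prod_diff_self:
      "scalar_prod (a - b) (a - b) = scalar_prod a a - 2 * scalar_prod a b + scalar_prod b b"
  using assms
  by (simp_all add: scalar_prod_def algebra_simps sum.distrib sum_subtractf sum_distrib_left)

text \<open>The squared norm of the projected errors, written as a quadratic form because the moment
  computation works with that shape.\<close>

definition fitted_ss :: "nat \<Rightarrow> (nat \<Rightarrow> 'x) \<Rightarrow> ('x \<Rightarrow> real) list \<Rightarrow> (nat \<Rightarrow> real) \<Rightarrow> real" where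
  "fitted_ss n x bs e = (\<Sum>i<n. \<Sum>j<n. proj_mat n x bs $$ (i, j) * (e i * e j))"

lemma fitted_ss_eq:
  "fitted_ss n x bs e
     = scalar_prod (proj_mat n x bs *\<^sub>v Matrix.vec n e) (proj_mat n x bs *\<^sub>v Matrix.vec n e)"
  unfolding orth_proj.norm_proj_eq_quadratic_form[OF orth_proj_proj_mat vec_carrier] fitted_ss_def
  by simp

lemma fitted_ss_nonneg: "0 \<le> fitted_ss n x bs e"
  unfolding fitted_ss_eq by (rule scalar_prod_self_nonneg)

lemma rss_nonneg: "0 \<le> rss n x bs y"
  by (simp add: rss_def)

lemma response_vec_eq: "response_vec n x f e = mean_vec n x f + Matrix.vec n e"
  by (rule eq_vecI) (simp_all add: response_vec_def mean_vec_def)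

lemma vec_add_diff_add:
  fixes a b c d :: "real Matrix.vec"
  assumes "a \<in> carrier_vec n" "b \<in> carrier_vec n" "c \<in> carrier_vec n" "d \<in> carrier_vec n"
  shows "(a + b) - (c + d) = (a - c) + (b - d)" and "(a - b) + (b - c) = a - c"
    and "(a + b) - b = a"
  using assms by (auto intro!: eq_vecI)

text \<open>The mean vector lies in the model space, so the projection fixes it and it drops out of
  the residual.\<close>

lemma residual_response:
  assumes f: "f \<in> regression_family bs"
  shows "response_vec n x f e - proj_mat n x bs *\<^sub>v response_vec n x f e
       = Matrix.vec n e - proj_mat n x bs *\<^sub>v Matrix.vec n e"
proof -
  interpret orth_proj n "model_space n x bs" "proj_mat n x bs" by (rule orth_proj_proj_mat)
  let ?M = "proj_mat n x bs" and ?f = "mean_vec n x f" and ?e = "Matrix.vec n e"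
  have "?M *\<^sub>v (?f + ?e) = ?M *\<^sub>v ?f + ?M *\<^sub>v ?e"
    by (rule mult_add_distrib_mat_vec[OF M_carrier]) simp_all
  also have "?M *\<^sub>v ?f = ?f" using f by (intro proj_fix) blast
  finally have "?f + ?e - ?M *\<^sub>v (?f + ?e) = (?f - ?f) + (?e - ?M *\<^sub>v ?e)"
    using vec_add_diff_add(1)[of ?f n ?e ?f "?M *\<^sub>v ?e"] by simp
  also have "?f - ?f = 0\<^sub>v n" by (rule minus_cancel_vec) simp
  also have "0\<^sub>v n + (?e - ?M *\<^sub>v ?e) = ?e - ?M *\<^sub>v ?e"
    by (rule left_zero_vec) simp
  finally show ?thesis by (simp add: response_vec_eq)
qed

text \<open>Pythagoras for the error vector. The residual sum of the true model is thereby a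
  difference of the two statistics whose deviations are controlled.\<close>

lemma rss_add_fitted_ss:
  assumes f: "f \<in> regression_family bs"
  shows "rss n x bs (response_vec n x f e) + fitted_ss n x bs e = (\<Sum>i<n. (e i)\<^sup>2)"
proof -
  interpret orth_proj n "model_space n x bs" "proj_mat n x bs" by (rule orth_proj_proj_mat)
  have "rss n x bs (response_vec n x f e) + fitted_ss n x bs e
      = scalar_prod (Matrix.vec n e) (Matrix.vec n e)"
    unfolding rss_def euclid_norm_sq residual_response[OF f] fitted_ss_eq
    by (rule pythagoras[symmetric]) simp
  then show ?thesis by (simp add: scalar_prod_def power2_eq_square lessThan_atLeast0)
qed

text \<open>Gives up half of the signal \<open>a\<close> so that the cross term with the noise
  \<open>b\<close>, which would vary with the sub-model, never has to be estimated.\<close>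

lemma scalar_prod_self_add_ge:
  assumes a: "a \<in> carrier_vec n" and b: "b \<in> carrier_vec n"
  shows "scalar_prod a a / 2 - scalar_prod b b \<le> scalar_prod (a + b) (a + (b :: real Matrix.vec))"
proof -
  have "scalar_prod a a / 2 - scalar_prod b b = (\<Sum>i = 0..<n. (a $ i)\<^sup>2 / 2 - (b $ i)\<^sup>2)"
    using a b by (simp add: scalar_prod_def sum_subtractf sum_divide_distrib power2_eq_square)
  also have "\<dots> \<le> (\<Sum>i = 0..<n. (a $ i + b $ i)\<^sup>2)"
  proof (rule sum_mono)
    fix i
    \<comment> \<open>Per coordinate,
      \<open>(a + b)^2 - a^2 / 2 + b^2 = (a + 2 b)^2 / 2\<close>.\<close>
    have "0 \<le> (a $ i + 2 * b $ i)\<^sup>2" by simp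
    then show "(a $ i)\<^sup>2 / 2 - (b $ i)\<^sup>2 \<le> (a $ i + b $ i)\<^sup>2"
      by (simp add: power2_eq_square algebra_simps)
  qed
  also have "\<dots> = scalar_prod (a + b) (a + b)"
    using a b by (simp add: scalar_prod_def power2_eq_square)
  finally show ?thesis .
qed

lemma rss_submodel_ge:
  assumes f: "f \<in> regression_family bs" and sub: "regression_family bs' \<subseteq> regression_family bs"
  shows "rss n x bs (response_vec n x f e)
      + (euclid_norm ((1\<^sub>m n - proj_mat n x bs') *\<^sub>v mean_vec n x f))\<^sup>2 / 2 - fitted_ss n x bs e
    \<le> rss n x bs' (response_vec n x f e)"
proof -
  interpret L: orth_proj n "model_space n x bs" "proj_mat n x bs" by (rule orth_proj_proj_mat)
  interpret S: orth_proj n "model_space n x bs'" "proj_mat n x bs'" by (rule orth_proj_proj_mat)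
  let ?M = "proj_mat n x bs" and ?M' = "proj_mat n x bs'"
  let ?f = "mean_vec n x f" and ?e = "Matrix.vec n e"
  let ?y = "?f + ?e"
  have WW: "w \<in> model_space n x bs" if "w \<in> model_space n x bs'" for w
    using that sub by blast
  have y: "?y \<in> carrier_vec n" by simp
  have fW: "?f \<in> model_space n x bs" using f by blast
  \<comment> \<open>\<open>r\<close> is the residual of the larger model and \<open>g\<close> the
    part of its fit that the smaller model loses. As \<open>g\<close> stays in the larger space,
    \<open>r\<close> and \<open>g\<close> are orthogonal.\<close>
  define r where "r = ?y - ?M *\<^sub>v ?y"
  define g where "g = ?M *\<^sub>v ?y - ?M' *\<^sub>v ?y"
  have rc: "r \<in> carrier_vec n" and gc: "g \<in> carrier_vec n" by (simp_all add: r_def g_def)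
  have "g \<in> model_space n x bs"
    unfolding g_def by (rule L.W_diff[OF L.M_in[OF y] WW[OF S.M_in[OF y]]])
  then have rg: "scalar_prod r g = 0" unfolding r_def by (rule L.M_orth[OF y])
  have split: "?y - ?M' *\<^sub>v ?y = r + g"
    unfolding r_def g_def by (rule vec_add_diff_add(2)[symmetric]) (rule y L.M_vec_carrier S.M_vec_carrier)+
  have "scalar_prod (r + g) (r + g) = scalar_prod r r + scalar_prod g g"
    using scalar_prod_add_self[OF rc gc] rg by simp
  then have rss': "rss n x bs' ?y = rss n x bs ?y + scalar_prod g g"
    unfolding rss_def euclid_norm_sq split r_def[symmetric] .
  \<comment> \<open>\<open>g\<close> splits into a signal part \<open>a\<close> and a noise part
    \<open>b\<close>; the larger projection has disappeared from \<open>a\<close> because it fixes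
    the mean vector.\<close>
  define a where "a = ?f - ?M' *\<^sub>v ?f"
  define b where "b = ?M *\<^sub>v ?e - ?M' *\<^sub>v ?e"
  have ac: "a \<in> carrier_vec n" and bc: "b \<in> carrier_vec n" by (simp_all add: a_def b_def)
  have "g = a + b"
  proof -
    have "?M *\<^sub>v ?y = ?f + ?M *\<^sub>v ?e"
      using mult_add_distrib_mat_vec[OF L.M_carrier, of ?f ?e] L.proj_fix[OF fW] by simp
    moreover have "?M' *\<^sub>v ?y = ?M' *\<^sub>v ?f + ?M' *\<^sub>v ?e"
      by (rule mult_add_distrib_mat_vec[OF S.M_carrier]) simp_all
    ultimately show ?thesis
      unfolding g_def a_def b_def
      using vec_add_diff_add(1)[of ?f n "?M *\<^sub>v ?e" "?M' *\<^sub>v ?f" "?M' *\<^sub>v ?e"] by simp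
  qed
  then have gg: "scalar_prod a a / 2 - scalar_prod b b \<le> scalar_prod g g"
    using scalar_prod_self_add_ge[OF ac bc] by simp
  \<comment> \<open>Since the spaces are nested, \<open>|b|^2 = |M e|^2 - |M' e|^2\<close>. The
    resulting bound involves the larger model alone and is therefore uniform over
    sub-models.\<close>
  have bb: "scalar_prod b b \<le> fitted_ss n x bs e"
  proof -
    have e: "?e \<in> carrier_vec n" by simp
    define p where "p = ?M' *\<^sub>v ?e"
    have p: "p \<in> model_space n x bs'" "p \<in> carrier_vec n"
      unfolding p_def using S.M_in[OF e] by simp_all
    have "scalar_prod (?M *\<^sub>v ?e) p = scalar_prod ?e p"
      by (rule L.scalar_prod_proj[OF e WW[OF p(1)]])
    also have "\<dots> = scalar_prod p p"
      unfolding p_def by (rule S.scalar_prod_proj_proj[OF e e, symmetric])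
    finally have Mp: "scalar_prod (?M *\<^sub>v ?e) p = scalar_prod p p" .
    have "scalar_prod b b = scalar_prod (?M *\<^sub>v ?e) (?M *\<^sub>v ?e) - scalar_prod p p"
      unfolding b_def p_def[symmetric]
      using scalar_prod_diff_self[OF L.M_vec_carrier p(2), of ?e] Mp by simp
    then show ?thesis using scalar_prod_self_nonneg[of p] by (simp add: fitted_ss_eq)
  qed
  have "(1\<^sub>m n - ?M') *\<^sub>v ?f = a"
    unfolding a_def using minus_mult_distrib_mat_vec[OF one_carrier_mat S.M_carrier, of ?f] by simp
  then show ?thesis
    using rss' gg bb by (simp add: euclid_norm_sq response_vec_eq)
qed

lemma model_rank_ge_trace: "mat_trace (proj_mat n x bs) \<le> real (model_rank n x bs)"
  unfolding model_rank_def by (rule orth_proj.mat_trace_le_rank[OF orth_proj_proj_mat])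

section \<open>Quadratic forms in independent normal variables\<close>

locale iid_normal = prob_space +
  fixes X :: "nat \<Rightarrow> 'a \<Rightarrow> real" and n :: nat and \<sigma> :: real
  assumes sigma_pos: "\<sigma> > 0"
    and indep: "indep_vars (\<lambda>_. borel) X {..<n}"
    and normal: "\<And>i. i < n \<Longrightarrow> distributed M lborel (X i) (normal_density 0 \<sigma>)"
begin

definition moment :: "nat \<Rightarrow> real" where
  "moment k = (\<integral>x. normal_density 0 \<sigma> x * x ^ k \<partial>lborel)"

lemma X_measurable: "i < n \<Longrightarrow> X i \<in> borel_measurable M"
  using indep by (auto simp: indep_vars_def)

lemma
  assumes "i < n"
  shows integrable_power: "integrable M (\<lambda>\<omega>. X i \<omega> ^ k)"
    and expectation_power: "expectation (\<lambda>\<omega>. X i \<omega> ^ k) = moment k"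
proof -
  show "integrable M (\<lambda>\<omega>. X i \<omega> ^ k)"
    using distributed_integrable[OF normal[OF assms], of "\<lambda>x. x ^ k"]
      integrable_normal_moment[OF sigma_pos, of 0 k] by simp
  show "expectation (\<lambda>\<omega>. X i \<omega> ^ k) = moment k"
    using distributed_integral[OF normal[OF assms], of "\<lambda>x. x ^ k"] by (simp add: moment_def)
qed

text \<open>Successor form, so that the equations rewrite the exponents that arise below as sums of
  \<open>of_bool\<close> values.\<close>

lemma moment_values:
  "moment 0 = 1" "moment (Suc 0) = 0" "moment (Suc (Suc 0)) = \<sigma>\<^sup>2"
  "moment (Suc (Suc (Suc 0))) = 0" "moment (Suc (Suc (Suc (Suc 0)))) = 3 * \<sigma> ^ 4"
proof -
  show "moment 0 = 1" using integral_normal_moment_even[OF sigma_pos, of 0 0] by (simp add: moment_def)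
  show "moment (Suc 0) = 0" using integral_normal_moment_odd[OF sigma_pos, of 0 0] by (simp add: moment_def)
  have "moment 2 = \<sigma>\<^sup>2"
    using integral_normal_moment_even[OF sigma_pos, of 0 1] sigma_pos by (simp add: moment_def)
  then show "moment (Suc (Suc 0)) = \<sigma>\<^sup>2" by (simp add: numeral_2_eq_2)
  have "moment 3 = 0"
    using integral_normal_moment_odd[OF sigma_pos, of 0 1] by (simp add: moment_def)
  then show "moment (Suc (Suc (Suc 0))) = 0" by (simp add: numeral_3_eq_3)
  have "moment 4 = 3 * \<sigma> ^ 4"
    using integral_normal_moment_even[OF sigma_pos, of 0 2] sigma_pos
    by (simp add: moment_def fact_numeral field_simps power2_eq_square power4_eq_xxxx)
  then show "moment (Suc (Suc (Suc (Suc 0)))) = 3 * \<sigma> ^ 4" by (simp add: eval_nat_numeral)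
qed

text \<open>Independence factorizes products over distinct indices only, so a monomial with repeated
  indices has to be collected into powers first.\<close>

lemma
  assumes I: "finite I" "I \<subseteq> {..<n}"
  shows integrable_prod_power: "integrable M (\<lambda>\<omega>. \<Prod>i\<in>I. X i \<omega> ^ c i)"
    and expectation_prod_power: "expectation (\<lambda>\<omega>. \<Prod>i\<in>I. X i \<omega> ^ c i) = (\<Prod>i\<in>I. moment (c i))"
proof -
  have ind: "indep_vars (\<lambda>_. borel) (\<lambda>i \<omega>. X i \<omega> ^ c i) I"
    by (rule indep_vars_compose2[OF indep_vars_subset[OF indep I(2)]]) simp
  have int: "integrable M (\<lambda>\<omega>. X i \<omega> ^ c i)" if "i \<in> I" for i
    using integrable_power that I by auto
  show "integrable M (\<lambda>\<omega>. \<Prod>i\<in>I. X i \<omega> ^ c i)"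
    by (rule indep_vars_integrable[OF I(1) ind int])
  have "expectation (\<lambda>\<omega>. \<Prod>i\<in>I. X i \<omega> ^ c i) = (\<Prod>i\<in>I. expectation (\<lambda>\<omega>. X i \<omega> ^ c i))"
    by (rule indep_vars_lebesgue_integral[OF I(1) ind int])
  also have "\<dots> = (\<Prod>i\<in>I. moment (c i))"
    using expectation_power I by (intro prod.cong) auto
  finally show "expectation (\<lambda>\<omega>. \<Prod>i\<in>I. X i \<omega> ^ c i) = (\<Prod>i\<in>I. moment (c i))" .
qed

definition kron :: "nat \<Rightarrow> nat \<Rightarrow> real" where
  "kron i j = (if i = j then 1 else 0)"

lemma
  assumes "i < n" "j < n"
  shows integrable_prod2: "integrable M (\<lambda>\<omega>. X i \<omega> * X j \<omega>)"
    and expectation_prod2: "expectation (\<lambda>\<omega>. X i \<omega> * X j \<omega>) = \<sigma>\<^sup>2 * kron i j"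
proof -
  \<comment> \<open>\<open>c m\<close> counts the occurrences of the index \<open>m\<close>; a
    product over the set \<open>{i, j}\<close> with these exponents covers equal and distinct
    indices alike.\<close>
  define c :: "nat \<Rightarrow> nat" where "c m = of_bool (m = i) + of_bool (m = j)" for m
  have I: "finite {i, j}" "{i, j} \<subseteq> {..<n}" using assms by auto
  have eq: "(\<Prod>m\<in>{i, j}. X m \<omega> ^ c m) = X i \<omega> * X j \<omega>" for \<omega>
    by (cases "i = j") (auto simp: c_def power2_eq_square)
  have val: "(\<Prod>m\<in>{i, j}. moment (c m)) = \<sigma>\<^sup>2 * kron i j"
    by (cases "i = j") (auto simp: c_def kron_def moment_values)
  show "integrable M (\<lambda>\<omega>. X i \<omega> * X j \<omega>)"
    using integrable_prod_power[OF I, of c] unfolding eq .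
  show "expectation (\<lambda>\<omega>. X i \<omega> * X j \<omega>) = \<sigma>\<^sup>2 * kron i j"
    using expectation_prod_power[OF I, of c] unfolding eq val .
qed

text \<open>Isserlis' formula for fourth moments.\<close>

lemma
  assumes "i < n" "j < n" "k < n" "l < n"
  shows integrable_prod4: "integrable M (\<lambda>\<omega>. X i \<omega> * X j \<omega> * (X k \<omega> * X l \<omega>))"
    and expectation_prod4: "expectation (\<lambda>\<omega>. X i \<omega> * X j \<omega> * (X k \<omega> * X l \<omega>))
      = \<sigma> ^ 4 * (kron i j * kron k l + kron i k * kron j l + kron i l * kron j k)"
proof -
  define c :: "nat \<Rightarrow> nat" where "c m = of_bool (m = i) + of_bool (m = j) + of_bool (m = k) + of_bool (m = l)" for m
  have I: "finite {i, j, k, l}" "{i, j, k, l} \<subseteq> {..<n}" using assms by auto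
  have eq: "(\<Prod>m\<in>{i, j, k, l}. X m \<omega> ^ c m) = X i \<omega> * X j \<omega> * (X k \<omega> * X l \<omega>)" for \<omega>
    by (cases "i = j"; cases "i = k"; cases "i = l"; cases "j = k"; cases "j = l"; cases "k = l")
      (simp_all add: c_def power2_eq_square insert_absorb)
  have val: "(\<Prod>m\<in>{i, j, k, l}. moment (c m))
      = \<sigma> ^ 4 * (kron i j * kron k l + kron i k * kron j l + kron i l * kron j k)"
    by (cases "i = j"; cases "i = k"; cases "i = l"; cases "j = k"; cases "j = l"; cases "k = l")
      (simp_all add: c_def kron_def moment_values insert_absorb power2_eq_square power4_eq_xxxx)
  show "integrable M (\<lambda>\<omega>. X i \<omega> * X j \<omega> * (X k \<omega> * X l \<omega>))"
    using integrable_prod_power[OF I, of c] unfolding eq .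
  show "expectation (\<lambda>\<omega>. X i \<omega> * X j \<omega> * (X k \<omega> * X l \<omega>))
      = \<sigma> ^ 4 * (kron i j * kron k l + kron i k * kron j l + kron i l * kron j k)"
    using expectation_prod_power[OF I, of c] unfolding eq val .
qed


section \<open>Mean, variance and concentration of a quadratic form\<close>

definition qform :: "(nat \<Rightarrow> nat \<Rightarrow> real) \<Rightarrow> 'a \<Rightarrow> real" where
  "qform a \<omega> = (\<Sum>i<n. \<Sum>j<n. a i j * (X i \<omega> * X j \<omega>))"

lemma qform_measurable: "qform a \<in> borel_measurable M"
  unfolding qform_def using X_measurable by (intro borel_measurable_sum borel_measurable_times) auto

lemma qform_sq:
  "(qform a \<omega>)\<^sup>2 = (\<Sum>i<n. \<Sum>j<n. \<Sum>k<n. \<Sum>l<n.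
      a i j * a k l * (X i \<omega> * X j \<omega> * (X k \<omega> * X l \<omega>)))"
proof -
  have "(qform a \<omega>)\<^sup>2 = (\<Sum>i<n. \<Sum>j<n. a i j * (X i \<omega> * X j \<omega>)) * qform a \<omega>"
    by (simp add: power2_eq_square qform_def)
  also have "\<dots> = (\<Sum>i<n. \<Sum>j<n. a i j * (X i \<omega> * X j \<omega>) * qform a \<omega>)"
    by (simp add: sum_distrib_right)
  also have "\<dots> = (\<Sum>i<n. \<Sum>j<n. \<Sum>k<n. \<Sum>l<n.
      a i j * a k l * (X i \<omega> * X j \<omega> * (X k \<omega> * X l \<omega>)))"
    by (intro sum.cong refl) (simp add: qform_def sum_distrib_left mult_ac)
  finally show ?thesis .
qed

lemma integrable_qform: "integrable M (qform a)"
  unfolding qform_def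
  by (intro Bochner_Integration.integrable_sum integrable_mult_right integrable_prod2) auto

lemma integrable_qform_sq: "integrable M (\<lambda>\<omega>. (qform a \<omega>)\<^sup>2)"
  unfolding qform_sq
  by (intro Bochner_Integration.integrable_sum integrable_mult_right integrable_prod4) auto

lemma sum_kron: "i < n \<Longrightarrow> (\<Sum>j<n. f j * kron i j) = f i"
  by (simp add: kron_def if_distrib cong: if_cong)

lemma expectation_qform: "expectation (qform a) = \<sigma>\<^sup>2 * (\<Sum>i<n. a i i)"
proof -
  have "has_bochner_integral M (qform a) (\<Sum>i<n. \<Sum>j<n. a i j * (\<sigma>\<^sup>2 * kron i j))"
    unfolding qform_def
    by (intro has_bochner_integral_sum has_bochner_integral_mult_right)
      (simp add: has_bochner_integral_iff integrable_prod2 expectation_prod2)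
  then have "expectation (qform a) = (\<Sum>i<n. \<Sum>j<n. a i j * (\<sigma>\<^sup>2 * kron i j))"
    by (rule has_bochner_integral_integral_eq)
  also have "\<dots> = (\<Sum>i<n. \<sigma>\<^sup>2 * (\<Sum>j<n. a i j * kron i j))"
    by (simp add: sum_distrib_left mult_ac)
  also have "\<dots> = (\<Sum>i<n. \<sigma>\<^sup>2 * a i i)"
    using sum_kron by (intro sum.cong) auto
  finally show ?thesis by (simp add: sum_distrib_left)
qed

text \<open>Of the three pairings in Isserlis' formula the first produces the squared trace; each of
  the other two produces the sum of squared entries, the last one by symmetry.\<close>

lemma expectation_qform_sq:
  assumes sym: "\<And>i j. i < n \<Longrightarrow> j < n \<Longrightarrow> a i j = a j i"
  shows "expectation (\<lambda>\<omega>. (qform a \<omega>)\<^sup>2)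
    = \<sigma> ^ 4 * ((\<Sum>i<n. a i i)\<^sup>2 + 2 * (\<Sum>i<n. \<Sum>j<n. (a i j)\<^sup>2))"
proof -
  let ?K = "\<lambda>i j k l. kron i j * kron k l + kron i k * kron j l + kron i l * kron j k"
  have "has_bochner_integral M (\<lambda>\<omega>. (qform a \<omega>)\<^sup>2)
      (\<Sum>i<n. \<Sum>j<n. \<Sum>k<n. \<Sum>l<n. a i j * a k l * (\<sigma> ^ 4 * ?K i j k l))"
    unfolding qform_sq
    by (intro has_bochner_integral_sum has_bochner_integral_mult_right)
      (simp add: has_bochner_integral_iff integrable_prod4 expectation_prod4)
  then have "expectation (\<lambda>\<omega>. (qform a \<omega>)\<^sup>2)
      = (\<Sum>i<n. \<Sum>j<n. \<Sum>k<n. \<Sum>l<n. a i j * a k l * (\<sigma> ^ 4 * ?K i j k l))"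
    by (rule has_bochner_integral_integral_eq)
  \<comment> \<open>Regrouped so that each Kronecker symbol sits in a sum over its own index and
    \<open>sum_kron\<close> can collapse it.\<close>
  also have "\<dots> = (\<Sum>i<n. \<Sum>j<n. \<sigma> ^ 4 * (a i j * kron i j * (\<Sum>k<n. \<Sum>l<n. a k l * kron k l)
      + a i j * (\<Sum>k<n. (\<Sum>l<n. a k l * kron j l) * kron i k)
      + a i j * (\<Sum>k<n. (\<Sum>l<n. a k l * kron i l) * kron j k)))"
    by (simp add: sum_distrib_left sum_distrib_right sum.distrib algebra_simps)
  also have "\<dots> = (\<Sum>i<n. \<Sum>j<n. \<sigma> ^ 4 * (a i j * kron i j * (\<Sum>k<n. a k k) + a i j * a i j + a i j * a j i))"
    by (intro sum.cong refl) (simp add: sum_kron)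
  also have "\<dots> = (\<Sum>i<n. \<Sum>j<n. \<sigma> ^ 4 * (\<Sum>k<n. a k k) * (a i j * kron i j) + 2 * \<sigma> ^ 4 * (a i j)\<^sup>2)"
    by (intro sum.cong refl) (use sym in \<open>simp add: power2_eq_square algebra_simps\<close>)
  also have "\<dots> = \<sigma> ^ 4 * (\<Sum>k<n. a k k) * (\<Sum>i<n. \<Sum>j<n. a i j * kron i j)
      + 2 * \<sigma> ^ 4 * (\<Sum>i<n. \<Sum>j<n. (a i j)\<^sup>2)"
    by (simp add: sum.distrib sum_distrib_left)
  also have "(\<Sum>i<n. \<Sum>j<n. a i j * kron i j) = (\<Sum>i<n. a i i)"
    by (intro sum.cong refl) (simp add: sum_kron)
  finally show ?thesis by (simp add: power2_eq_square algebra_simps)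
qed

lemma variance_qform:
  assumes sym: "\<And>i j. i < n \<Longrightarrow> j < n \<Longrightarrow> a i j = a j i"
  shows "variance (qform a) = 2 * \<sigma> ^ 4 * (\<Sum>i<n. \<Sum>j<n. (a i j)\<^sup>2)"
proof -
  have "variance (qform a) = expectation (\<lambda>\<omega>. (qform a \<omega>)\<^sup>2) - (expectation (qform a))\<^sup>2"
    by (rule variance_eq[OF integrable_qform integrable_qform_sq])
  then show ?thesis
    using expectation_qform_sq[OF sym]
    by (simp add: expectation_qform power2_eq_square power4_eq_xxxx algebra_simps)
qed

text \<open>Chebyshev at the scale \<open>sqrt n\<close>, where \<open>n\<close> and
  \<open>\<sigma>\<close> cancel. The bound on squared entries fits the identity, where their sum is
  \<open>n\<close>, and every projection, where it is the trace.\<close>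

lemma qform_concentration:
  assumes sym: "\<And>i j. i < n \<Longrightarrow> j < n \<Longrightarrow> a i j = a j i"
    and sq: "(\<Sum>i<n. \<Sum>j<n. (a i j)\<^sup>2) \<le> real n" and n: "n > 0" and t: "t > 0"
  shows "prob {\<omega> \<in> space M. t * sqrt (real n) * \<sigma>\<^sup>2 \<le> \<bar>qform a \<omega> - \<sigma>\<^sup>2 * (\<Sum>i<n. a i i)\<bar>} \<le> 2 / t\<^sup>2"
proof -
  have pos: "t * sqrt (real n) * \<sigma>\<^sup>2 > 0" using n t sigma_pos by simp
  have "prob {\<omega> \<in> space M. t * sqrt (real n) * \<sigma>\<^sup>2 \<le> \<bar>qform a \<omega> - expectation (qform a)\<bar>}
      \<le> variance (qform a) / (t * sqrt (real n) * \<sigma>\<^sup>2)\<^sup>2"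
    by (rule Chebyshev_inequality[OF qform_measurable integrable_qform_sq pos])
  also have "\<dots> = 2 * \<sigma> ^ 4 * (\<Sum>i<n. \<Sum>j<n. (a i j)\<^sup>2) / (t\<^sup>2 * real n * \<sigma> ^ 4)"
    by (simp add: variance_qform[OF sym] power_mult_distrib flip: power_mult)
  also have "\<dots> \<le> 2 * \<sigma> ^ 4 * real n / (t\<^sup>2 * real n * \<sigma> ^ 4)"
    using sq by (intro divide_right_mono mult_left_mono) auto
  also have "\<dots> = 2 / t\<^sup>2" using n t sigma_pos by simp
  finally show ?thesis by (simp add: expectation_qform)
qed

end

section \<open>The index on the good event\<close>

text \<open>For \<open>y = 0\<close> the second assumption gives no strict sign; positivity of
  \<open>x\<close> then makes the extended quotient \<infinity>.\<close>

lemma ereal_ratio_ge: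
  assumes "0 < x" "C * \<bar>y\<bar> \<le> x" "0 \<le> y"
  shows "ereal C \<le> ereal x / ereal y"
proof (cases "y = 0")
  case True
  then show ?thesis using assms by (simp add: divide_ereal_def)
next
  case False
  then show ?thesis using assms by (simp add: field_simps)
qed

lemma param_index_ge:
  assumes "model_rank n x (B k) > 1"
    and big: "\<And>k'. k' \<in> submodels1 n x B \<Gamma> k \<Longrightarrow>
      0 < info_crit n x lam d s2 y (B k') \<and>
      C * \<bar>info_crit n x lam d s2 y (B k)\<bar> \<le> info_crit n x lam d s2 y (B k')"
    and "0 \<le> info_crit n x lam d s2 y (B k)"
  shows "ereal C \<le> param_index n x B \<Gamma> lam d s2 y k"
proof -
  have "ereal C \<le> ereal (info_crit n x lam d s2 y (B k')) / ereal (info_crit n x lam d s2 y (B k))"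
    if "k' \<in> submodels1 n x B \<Gamma> k" for k'
    using big[OF that] assms(3) by (intro ereal_ratio_ge) auto
  then show ?thesis
    unfolding param_index_def if_P[OF assms(1)] by (rule INF_greatest)
qed

lemma abs_param_index_ge:
  assumes rk: "model_rank n x (B k) > 1"
    and ne: "submodels1 n x B \<Gamma> k \<noteq> {}"
    and big: "\<And>k'. k' \<in> submodels1 n x B \<Gamma> k \<Longrightarrow>
      0 < info_crit n x lam d s2 y (B k') \<and>
      C * \<bar>info_crit n x lam d s2 y (B k)\<bar> \<le> info_crit n x lam d s2 y (B k')"
  shows "ereal C \<le> \<bar>param_index n x B \<Gamma> lam d s2 y k\<bar>"
proof (cases "0 \<le> info_crit n x lam d s2 y (B k)")
  case True
  have "ereal C \<le> param_index n x B \<Gamma> lam d s2 y k"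
    by (rule param_index_ge[of n x B k, OF rk big True])
  also have "\<dots> \<le> \<bar>\<dots>\<bar>" by (cases "param_index n x B \<Gamma> lam d s2 y k") auto
  finally show ?thesis .
next
  case False
  \<comment> \<open>With a negative denominator the ratios are at most \<open>- C\<close>, and a
    single sub-model already pulls the infimum down to that level; over an empty set the infimum
    would be \<infinity>.\<close>
  obtain k' where k': "k' \<in> submodels1 n x B \<Gamma> k" using ne by blast
  have "param_index n x B \<Gamma> lam d s2 y k
      \<le> ereal (info_crit n x lam d s2 y (B k')) / ereal (info_crit n x lam d s2 y (B k))"
    unfolding param_index_def if_P[OF rk] by (rule INF_lower[OF k'])
  also have "\<dots> \<le> ereal (- C)"
    using False big[OF k'] by (simp add: field_simps)
  finally show ?thesis by (cases "param_index n x B \<Gamma> lam d s2 y k") auto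
qed

lemma signal_gap_le:
  assumes "k' \<in> submodels1 n x B \<Gamma> k"
  shows "signal_gap n x B \<Gamma> f \<sigma> k
    \<le> (euclid_norm ((1\<^sub>m n - proj_mat n x (B k')) *\<^sub>v mean_vec n x f))\<^sup>2 / \<sigma>\<^sup>2"
  unfolding signal_gap_def using assms
  by (intro cINF_lower bdd_belowI[of _ 0]) auto

text \<open>One sample size and one realization \<open>e\<close> of the errors satisfying both
  deviation bounds, so all that follows here is deterministic. \<open>\<alpha>\<close> is the
  permitted deviation in units of \<open>\<sigma>\<^sup>2\<close>, and \<open>C\<close> the level
  the index has to reach.\<close>

locale good_errors =
  fixes n :: nat and x :: "nat \<Rightarrow> 'x" and f :: "'x \<Rightarrow> real" and B :: "'k \<Rightarrow> ('x \<Rightarrow> real) list"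
    and \<Gamma> :: "'k set" and k :: 'k and e :: "nat \<Rightarrow> real" and lam d \<sigma> \<alpha> C :: real
  assumes true_f: "f \<in> regression_family (B k)"
    and rank_gt_1: "model_rank n x (B k) > 1"
    and submodels: "submodels1 n x B \<Gamma> k \<noteq> {}"
    and sigma_pos: "\<sigma> > 0" and d_nonneg: "d \<ge> 0" and n2: "n \<ge> 2"
    and lam_ge: "lam \<ge> 1 / ln (real n)" and C_pos: "C > 0"
    and errors_ss: "\<bar>(\<Sum>i<n. (e i)\<^sup>2) - real n * \<sigma>\<^sup>2\<bar> < \<alpha> * \<sigma>\<^sup>2"
    and fitted: "\<bar>fitted_ss n x (B k) e - mat_trace (proj_mat n x (B k)) * \<sigma>\<^sup>2\<bar> < \<alpha> * \<sigma>\<^sup>2"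
begin

abbreviation "y \<equiv> response_vec n x f e"
abbreviation "rk \<equiv> real (model_rank n x (B k))"
abbreviation "pen \<equiv> lam * ln (real n)"
abbreviation "dev \<equiv> d * sqrt (real n) * ln (real n)"
abbreviation "RSS \<equiv> rss n x (B k) y"

lemma ln_pos: "0 < ln (real n)" using n2 by simp

lemma pen_ge_1: "1 \<le> pen"
  using lam_ge ln_pos by (simp add: divide_le_eq)

lemma dev_nonneg: "0 \<le> dev" using d_nonneg ln_pos by simp

lemma rk_ge: "2 \<le> rk" using rank_gt_1 by simp

lemma s2_pos: "0 < \<sigma>\<^sup>2" using sigma_pos by simp

lemma alpha_pos: "0 < \<alpha>"
  using errors_ss s2_pos by (metis abs_ge_zero linorder_not_less mult_nonpos_nonneg order_le_less_trans order_less_imp_le)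

lemma pen_rk: "rk \<le> pen * rk" "pen \<le> pen * rk"
  using pen_ge_1 rk_ge mult_right_mono[of 1 pen rk] mult_left_mono[of 1 rk pen] by auto

lemma fitted_le: "fitted_ss n x (B k) e \<le> (rk + \<alpha>) * \<sigma>\<^sup>2"
proof -
  have "mat_trace (proj_mat n x (B k)) * \<sigma>\<^sup>2 \<le> rk * \<sigma>\<^sup>2"
    using model_rank_ge_trace by (intro mult_right_mono) auto
  then show ?thesis using fitted by (simp add: distrib_right)
qed

lemma RSS_eq: "RSS = (\<Sum>i<n. (e i)\<^sup>2) - fitted_ss n x (B k) e"
  using rss_add_fitted_ss[OF true_f, of n x e] by simp

text \<open>With a common \<open>s2\<close> the two criteria differ in the residual sums and, as the
  ranks differ by exactly one, in a single penalty unit \<open>pen * s2\<close>.\<close>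

lemma info_crit_submodel:
  assumes "k' \<in> submodels1 n x B \<Gamma> k" "0 \<le> s2"
  shows "info_crit n x lam d s2 y (B k) + signal_gap n x B \<Gamma> f \<sigma> k * \<sigma>\<^sup>2 / 2
      - (rk + \<alpha>) * \<sigma>\<^sup>2 - pen * s2 \<le> info_crit n x lam d s2 y (B k')"
proof -
  have sub: "regression_family (B k') \<subseteq> regression_family (B k)"
    and rank: "rk = real (model_rank n x (B k')) + 1"
    using assms(1) by (auto simp: submodels1_def simp flip: of_nat_Suc)
  have "signal_gap n x B \<Gamma> f \<sigma> k * \<sigma>\<^sup>2
      \<le> (euclid_norm ((1\<^sub>m n - proj_mat n x (B k')) *\<^sub>v mean_vec n x f))\<^sup>2"
    using signal_gap_le[OF assms(1), of f \<sigma>] s2_pos by (simp add: le_divide_eq)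
  then have "RSS + signal_gap n x B \<Gamma> f \<sigma> k * \<sigma>\<^sup>2 / 2 - (rk + \<alpha>) * \<sigma>\<^sup>2 \<le> rss n x (B k') y"
    using rss_submodel_ge[OF true_f sub, of n x e] fitted_le by linarith
  then show ?thesis
    unfolding info_crit_def rank by (simp add: algebra_simps)
qed

text \<open>In units of \<open>\<sigma>\<^sup>2\<close> the bracket \<open>u\<close> bounds the
  absolute criterion at \<open>k\<close>, the noise loss and the penalty unit. Three copies of
  \<open>u\<close> are lost, so the criterion at \<open>k'\<close> exceeds
  \<open>(2 + 4 * C) * u\<close>.\<close>

lemma known_variance:
  assumes gap: "(5 + 4 * C) * (2 * \<alpha> + rk + pen * rk + dev) < signal_gap n x B \<Gamma> f \<sigma> k / 2"
    and k': "k' \<in> submodels1 n x B \<Gamma> k"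
  shows "0 < info_crit n x lam d (\<sigma>\<^sup>2) y (B k') \<and>
    C * \<bar>info_crit n x lam d (\<sigma>\<^sup>2) y (B k)\<bar> \<le> info_crit n x lam d (\<sigma>\<^sup>2) y (B k')"
proof -
  let ?u = "2 * \<alpha> + rk + pen * rk + dev"
  let ?IC = "info_crit n x lam d (\<sigma>\<^sup>2) y (B k)"
  have u: "0 \<le> ?u" using alpha_pos rk_ge pen_rk dev_nonneg by linarith
  have IC: "?IC = ((\<Sum>i<n. (e i)\<^sup>2) - real n * \<sigma>\<^sup>2) - fitted_ss n x (B k) e + (pen * rk + dev) * \<sigma>\<^sup>2"
    unfolding info_crit_def RSS_eq by (simp add: algebra_simps)
  have nn: "0 \<le> (pen * rk) * \<sigma>\<^sup>2" "0 \<le> dev * \<sigma>\<^sup>2" "0 \<le> rk * \<sigma>\<^sup>2" "0 \<le> \<alpha> * \<sigma>\<^sup>2"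
    using pen_ge_1 rk_ge dev_nonneg s2_pos alpha_pos by auto
  have "\<bar>?IC\<bar> \<le> ?u * \<sigma>\<^sup>2"
  proof (rule abs_leI)
    have eq: "?u * \<sigma>\<^sup>2 = 2 * (\<alpha> * \<sigma>\<^sup>2) + rk * \<sigma>\<^sup>2 + pen * rk * \<sigma>\<^sup>2 + dev * \<sigma>\<^sup>2"
      by (simp add: algebra_simps)
    have fl: "fitted_ss n x (B k) e \<le> rk * \<sigma>\<^sup>2 + \<alpha> * \<sigma>\<^sup>2"
      using fitted_le by (simp add: distrib_right)
    show "?IC \<le> ?u * \<sigma>\<^sup>2" "- ?IC \<le> ?u * \<sigma>\<^sup>2"
      unfolding IC eq distrib_right
      using errors_ss fl fitted_ss_nonneg[of n x "B k" e] nn by linarith+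
  qed
  have "(rk + \<alpha>) * \<sigma>\<^sup>2 \<le> ?u * \<sigma>\<^sup>2" "pen * \<sigma>\<^sup>2 \<le> ?u * \<sigma>\<^sup>2"
    using alpha_pos rk_ge pen_rk dev_nonneg by (auto intro!: mult_right_mono)
  moreover have "(5 + 4 * C) * ?u * \<sigma>\<^sup>2 < signal_gap n x B \<Gamma> f \<sigma> k / 2 * \<sigma>\<^sup>2"
    using gap s2_pos by (intro mult_strict_right_mono) auto
  moreover have "0 \<le> C * (?u * \<sigma>\<^sup>2)" "0 \<le> ?u * \<sigma>\<^sup>2"
    using C_pos u by auto
  moreover have "C * \<bar>?IC\<bar> \<le> C * (?u * \<sigma>\<^sup>2)"
    using C_pos \<open>\<bar>?IC\<bar> \<le> _\<close> by (intro mult_left_mono) auto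
  moreover have "(5 + 4 * C) * ?u * \<sigma>\<^sup>2 = 5 * (?u * \<sigma>\<^sup>2) + 4 * (C * (?u * \<sigma>\<^sup>2))"
    by (simp add: algebra_simps)
  ultimately show ?thesis
    using info_crit_submodel[OF k' less_imp_le[OF s2_pos]] \<open>\<bar>?IC\<bar> \<le> _\<close> by linarith
qed

text \<open>The source of the constant \<open>5 + 4 * C\<close>: since \<open>s2\<close> can reach
  \<open>4 * \<sigma>\<^sup>2\<close>, one copy of \<open>u\<close> is lost to noise and four to the
  penalty unit, and the remaining \<open>4 * C * u\<close> must still cover \<open>C\<close> times a
  criterion as large as \<open>4 * u\<close>.\<close>

lemma estimated_variance:
  assumes gap: "(5 + 4 * C) * (2 * \<alpha> + rk + pen * rk + dev) < signal_gap n x B \<Gamma> f \<sigma> k / 2"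
    and small: "\<alpha> \<le> real n" "rk \<le> real n / 2"
    and k': "k' \<in> submodels1 n x B \<Gamma> k"
  defines "s2 \<equiv> sigma2_hat n x (B k) y"
  shows "0 \<le> info_crit n x lam d s2 y (B k)"
    and "0 < info_crit n x lam d s2 y (B k') \<and>
    C * \<bar>info_crit n x lam d s2 y (B k)\<bar> \<le> info_crit n x lam d s2 y (B k')"
proof -
  let ?u = "2 * \<alpha> + rk + pen * rk + dev"
  let ?IC = "info_crit n x lam d s2 y (B k)"
  have df: "0 < real n - rk" using small n2 by simp
  have s2_nonneg: "0 \<le> s2" unfolding s2_def sigma2_hat_def
    using rss_nonneg df by (intro divide_nonneg_pos)
  have "RSS \<le> (real n + \<alpha>) * \<sigma>\<^sup>2"
    using RSS_eq errors_ss fitted_ss_nonneg[of n x "B k" e] by (simp add: distrib_right abs_less_iff)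
  \<comment> \<open>\<open>n + \<alpha> \<le> 2 n\<close> and \<open>n - rk \<ge> n / 2\<close>,
    hence the factor 4.\<close>
  also have "\<dots> \<le> (4 * (real n - rk)) * \<sigma>\<^sup>2"
    using small by (intro mult_right_mono) auto
  finally have s2_le: "s2 \<le> 4 * \<sigma>\<^sup>2"
    unfolding s2_def sigma2_hat_def using df by (subst pos_divide_le_eq) (simp_all add: algebra_simps)
  \<comment> \<open>By the choice of the estimator the residual sum cancels \<open>n * s2\<close> up
    to \<open>rk * s2\<close>, so the noise enters the criterion at \<open>k\<close> only through
    the factor \<open>s2\<close>; the other factor is nonnegative as
    \<open>pen \<ge> 1\<close>.\<close>
  have "RSS = s2 * (real n - rk)"
    unfolding s2_def sigma2_hat_def using df by simp
  then have IC: "?IC = s2 * (pen * rk - rk + dev)"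
    unfolding info_crit_def by (simp add: algebra_simps)
  have fac: "0 \<le> pen * rk - rk + dev" "pen * rk - rk + dev \<le> ?u"
    using pen_rk dev_nonneg alpha_pos rk_ge by linarith+
  show IC_nonneg: "0 \<le> ?IC" unfolding IC using s2_nonneg fac by simp
  have IC_le: "?IC \<le> 4 * \<sigma>\<^sup>2 * ?u"
    unfolding IC using s2_le fac s2_nonneg by (intro mult_mono) auto
  have u: "0 \<le> ?u" using fac by linarith
  have "pen * s2 \<le> ?u * (4 * \<sigma>\<^sup>2)"
    using s2_le s2_nonneg pen_rk(2) alpha_pos rk_ge dev_nonneg u by (intro mult_mono) auto
  moreover have "(rk + \<alpha>) * \<sigma>\<^sup>2 \<le> ?u * \<sigma>\<^sup>2"
    using alpha_pos rk_ge pen_rk dev_nonneg by (intro mult_right_mono) auto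
  moreover have "(5 + 4 * C) * ?u * \<sigma>\<^sup>2 < signal_gap n x B \<Gamma> f \<sigma> k / 2 * \<sigma>\<^sup>2"
    using gap s2_pos by (intro mult_strict_right_mono) auto
  moreover have "0 \<le> C * (?u * \<sigma>\<^sup>2)" "0 \<le> ?u * \<sigma>\<^sup>2"
    using C_pos u by auto
  moreover have "C * \<bar>?IC\<bar> \<le> C * (4 * \<sigma>\<^sup>2 * ?u)"
    using C_pos IC_le IC_nonneg by (intro mult_left_mono) auto
  moreover have "(5 + 4 * C) * ?u * \<sigma>\<^sup>2 = 5 * (?u * \<sigma>\<^sup>2) + 4 * (C * (?u * \<sigma>\<^sup>2))"
    "C * (4 * \<sigma>\<^sup>2 * ?u) = 4 * (C * (?u * \<sigma>\<^sup>2))" "?u * (4 * \<sigma>\<^sup>2) = 4 * (?u * \<sigma>\<^sup>2)"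
    by (simp_all add: algebra_simps)
  ultimately show "0 < info_crit n x lam d s2 y (B k') \<and>
      C * \<bar>?IC\<bar> \<le> info_crit n x lam d s2 y (B k')"
    using info_crit_submodel[OF k' s2_nonneg] IC_nonneg by linarith
qed

text \<open>
  Needed only for the signed index with known variance. Writing \<open>a\<close> for the growth rate in the deviation
  bounds, \<open>\<alpha> = a n\<^sup>1\<^sup>/\<^sup>2\<close> has to be below half of the deterministic surplus.
\<close>

lemma info_crit_nonneg:
  assumes "2 * \<alpha> \<le> (pen - 1) * rk + dev"
  shows "0 \<le> info_crit n x lam d (\<sigma>\<^sup>2) y (B k)"
proof -
  have "(2 * \<alpha>) * \<sigma>\<^sup>2 \<le> ((pen - 1) * rk + dev) * \<sigma>\<^sup>2"
    using assms by (intro mult_right_mono) auto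
  moreover have "info_crit n x lam d (\<sigma>\<^sup>2) y (B k)
      = ((\<Sum>i<n. (e i)\<^sup>2) - real n * \<sigma>\<^sup>2) - fitted_ss n x (B k) e + (pen * rk + dev) * \<sigma>\<^sup>2"
    unfolding info_crit_def RSS_eq by (simp add: algebra_simps)
  ultimately show ?thesis
    using errors_ss fitted_le by (simp add: algebra_simps abs_less_iff)
qed

end

section \<open>Convergence in probability\<close>

lemma (in prob_space) prob_Int_tendsto_1:
  assumes A: "\<And>n. A n \<in> events" "(\<lambda>n. prob (A n)) \<longlonglongrightarrow> 1"
    and B: "\<And>n. B n \<in> events" "(\<lambda>n. prob (B n)) \<longlonglongrightarrow> 1"
  shows "(\<lambda>n. prob (A n \<inter> B n)) \<longlonglongrightarrow> 1"
proof (rule tendsto_sandwich)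
  show "\<forall>\<^sub>F n in sequentially. prob (A n) + prob (B n) - 1 \<le> prob (A n \<inter> B n)"
  proof (intro always_eventually allI)
    fix n
    have "prob (A n) - prob (A n \<inter> B n) = prob (A n - B n)"
      using finite_measure_Diff'[OF A(1) B(1), of n n] by simp
    also have "\<dots> \<le> prob (space M - B n)"
      using sets.sets_into_space[OF A(1), of n] B(1) by (intro finite_measure_mono) auto
    also have "\<dots> = 1 - prob (B n)" using B(1) by (rule prob_compl)
    finally show "prob (A n) + prob (B n) - 1 \<le> prob (A n \<inter> B n)" by simp
  qed
  show "(\<lambda>n. prob (A n) + prob (B n) - 1) \<longlonglongrightarrow> 1"
    using tendsto_diff[OF tendsto_add[OF A(2) B(2)] tendsto_const[of 1]] by simp
qed auto

text \<open>The definition demands the inclusion of events at every \<open>n\<close>. Emptying the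
  first finitely many events leaves the limit unchanged, so an eventual bound is enough.\<close>

lemma tends_to_infinity_in_probI:
  assumes "prob_space P"
    and *: "\<And>C. C > 0 \<Longrightarrow> \<exists>E. (\<forall>n. E n \<in> sets P) \<and> (\<lambda>n. measure P (E n)) \<longlonglongrightarrow> 1 \<and>
      (\<forall>\<^sub>F n in sequentially. \<forall>\<omega>\<in>E n. ereal C \<le> X n \<omega>)"
  shows "tends_to_infinity_in_prob P X"
  unfolding tends_to_infinity_in_prob_def
proof (intro allI impI)
  fix C :: real assume "C > 0"
  then obtain E where E: "\<And>n. E n \<in> sets P" "(\<lambda>n. measure P (E n)) \<longlonglongrightarrow> 1"
    and ev: "\<forall>\<^sub>F n in sequentially. \<forall>\<omega>\<in>E n. ereal C \<le> X n \<omega>"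
    using * by blast
  obtain N where N: "\<And>n. n \<ge> N \<Longrightarrow> \<forall>\<omega>\<in>E n. ereal C \<le> X n \<omega>"
    using ev by (auto simp: eventually_sequentially)
  define E' where "E' n = (if n \<ge> N then E n else {})" for n
  have "(\<lambda>n. measure P (E' n)) \<longlonglongrightarrow> 1"
  proof (rule Lim_transform_eventually[OF E(2)])
    show "\<forall>\<^sub>F n in sequentially. measure P (E n) = measure P (E' n)"
      using eventually_ge_at_top[of N] by eventually_elim (simp add: E'_def)
  qed
  moreover have "E' n \<in> sets P \<and> E' n \<subseteq> {\<omega> \<in> space P. ereal C \<le> X n \<omega>}" for n
    using E(1)[of n] N[of n] sets.sets_into_space[OF E(1), of n] by (auto simp: E'_def)
  ultimately show "\<exists>E. (\<forall>n. E n \<in> sets P \<and> E n \<subseteq> {\<omega> \<in> space P. ereal C \<le> X n \<omega>}) \<and>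
      (\<lambda>n. measure P (E n)) \<longlonglongrightarrow> 1" by blast
qed

text \<open>The divergent rate \<open>a\<close> stays free because two rates are used later: a small
  power of \<open>n\<close>, and one adapted to the surplus of the criterion.\<close>

lemma qform_event_tendsto_1:
  fixes \<epsilon> :: "nat \<Rightarrow> nat \<Rightarrow> 'a \<Rightarrow> real" and q :: "nat \<Rightarrow> nat \<Rightarrow> nat \<Rightarrow> real"
  assumes iid: "\<And>n. iid_normal P (\<epsilon> n) n \<sigma>"
    and sym: "\<And>n i j. i < n \<Longrightarrow> j < n \<Longrightarrow> q n i j = q n j i"
    and sq: "\<And>n. (\<Sum>i<n. \<Sum>j<n. (q n i j)\<^sup>2) \<le> real n"
    and a: "filterlim a at_top sequentially"
  defines "E \<equiv> \<lambda>n. {\<omega> \<in> space P. \<bar>(\<Sum>i<n. \<Sum>j<n. q n i j * (\<epsilon> n i \<omega> * \<epsilon> n j \<omega>)) - (\<Sum>i<n. q n i i) * \<sigma>\<^sup>2\<bar>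
      < a n * sqrt (real n) * \<sigma>\<^sup>2}"
  shows "E n \<in> sets P" and "(\<lambda>n. measure P (E n)) \<longlonglongrightarrow> 1"
proof -
  let ?Q = "\<lambda>n. iid_normal.qform (\<epsilon> n) n (q n)"
  have E: "E n = {\<omega> \<in> space P. \<bar>?Q n \<omega> - \<sigma>\<^sup>2 * (\<Sum>i<n. q n i i)\<bar> < a n * sqrt (real n) * \<sigma>\<^sup>2}" for n
    unfolding E_def iid_normal.qform_def[OF iid] by (simp add: mult.commute)
  have Qm: "?Q n \<in> borel_measurable P" for n
    by (rule iid_normal.qform_measurable[OF iid])
  show meas: "E n \<in> sets P" for n
    unfolding E using Qm[of n] by measurable
  interpret prob_space P
    using iid[of 0] by (simp add: iid_normal_def)
  show "(\<lambda>n. prob (E n)) \<longlonglongrightarrow> 1"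
  proof (rule tendsto_sandwich)
    have "((\<lambda>t. 1 - 2 / t\<^sup>2) \<longlongrightarrow> 1) (at_top :: real filter)" by real_asymp
    then show "(\<lambda>n. 1 - 2 / (a n)\<^sup>2) \<longlonglongrightarrow> 1"
      using a by (rule filterlim_compose)
    show "\<forall>\<^sub>F n in sequentially. 1 - 2 / (a n)\<^sup>2 \<le> prob (E n)"
      using eventually_gt_at_top[of 0] filterlim_at_top_dense[THEN iffD1, OF a, rule_format, of 0]
    proof eventually_elim
      case (elim n)
      have "prob (space P - E n) \<le> 2 / (a n)\<^sup>2"
        using iid_normal.qform_concentration[OF iid sym sq elim] unfolding E
        by (simp add: set_diff_eq not_less conj_commute cong: conj_cong)
      then show ?case using prob_compl[OF meas[of n]] by simp
    qed
  qed auto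
qed

section \<open>Comparison of growth rates\<close>

lemma signal_dominates:
  fixes A u N :: "nat \<Rightarrow> real" and C :: real
  assumes liminf: "liminf (\<lambda>n. ereal (A n / N n)) > 0" and u: "u \<in> o(N)"
    and N: "\<forall>\<^sub>F n in sequentially. N n > 0" and C: "C > 0"
  shows "\<forall>\<^sub>F n in sequentially. C * u n < A n"
proof -
  obtain c where c: "0 < ereal c" "ereal c < liminf (\<lambda>n. ereal (A n / N n))"
    using ereal_dense2[OF liminf] by auto
  have "\<forall>\<^sub>F n in sequentially. ereal c < ereal (A n / N n)"
    by (rule less_LiminfD[OF c(2)])
  \<comment> \<open>The extra factor 2 makes the final inequality strict.\<close>
  moreover have "\<forall>\<^sub>F n in sequentially. norm (u n) \<le> c / (2 * C) * norm (N n)"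
    using c C by (intro landau_o.smallD[OF u]) auto
  ultimately show ?thesis using N
  proof eventually_elim
    case (elim n)
    then have "C * u n \<le> C * (c / (2 * C) * N n)"
      using C by (intro mult_left_mono) auto
    also have "\<dots> = c / 2 * N n" using C by simp
    also have "\<dots> < c * N n" using c elim by simp
    also have "\<dots> < A n" using elim by (simp add: less_divide_eq)
    finally show ?case .
  qed
qed

text \<open>The deviation term has exponent \<open>1/2 + \<tau>/2 < 1/2 + \<tau>\<close>, the
  logarithm is below any positive power, and \<open>r\<close> is dominated by \<open>pen * r\<close>
  because \<open>pen \<ge> 1\<close>.\<close>

lemma penalty_smallo:
  fixes r :: "nat \<Rightarrow> real"
  assumes tau: "\<tau> > 0" and "(\<lambda>n. pen n * r n) \<in> o(\<lambda>n. real n powr (1 / 2 + \<tau>))"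
    and le: "\<forall>\<^sub>F n in sequentially. 0 \<le> r n \<and> 1 \<le> pen n"
  shows "(\<lambda>n. 2 * (real n powr (\<tau> / 2) * sqrt (real n)) + r n + pen n * r n + d * sqrt (real n) * ln (real n))
    \<in> o(\<lambda>n. real n powr (1 / 2 + \<tau>))"
proof -
  have "(\<lambda>n. 2 * (real n powr (\<tau> / 2) * sqrt (real n))) \<in> o(\<lambda>n. real n powr (1 / 2 + \<tau>))"
    using tau by real_asymp
  moreover have "(\<lambda>n. d * sqrt (real n) * ln (real n)) \<in> o(\<lambda>n. real n powr (1 / 2 + \<tau>))"
  proof -
    have "(\<lambda>n. sqrt (real n) * ln (real n)) \<in> o(\<lambda>n. real n powr (1 / 2 + \<tau>))"
      using tau by real_asymp
    then show ?thesis by (cases "d = 0") (simp_all add: mult.assoc)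
  qed
  moreover have "r \<in> o(\<lambda>n. real n powr (1 / 2 + \<tau>))"
  proof (rule landau_o.big_small_trans[OF _ assms(2)])
    show "r \<in> O(\<lambda>n. pen n * r n)"
    proof (rule bigoI[of _ 1])
      show "\<forall>\<^sub>F n in sequentially. norm (r n) \<le> 1 * norm (pen n * r n)"
        using le
      proof eventually_elim
        case (elim n)
        then show ?case using mult_right_mono[of 1 "pen n" "r n"] by simp
      qed
    qed
  qed
  ultimately show ?thesis using assms(2) by (intro sum_in_smallo(1)) auto
qed

text \<open>For known variance the criterion at the true model is a deterministic surplus plus
  fluctuations of order at most \<open>sqrt n\<close>. The signed claim therefore asks for a surplus
  outgrowing \<open>sqrt n\<close>, by \<open>d > 0\<close> or by the penalty; the claim on absolute
  values holds without fixing the sign.\<close>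

theorem theorem1:
  fixes P :: "'a measure"
    and x :: "nat \<Rightarrow> nat \<Rightarrow> real ^ 'p"
    and f :: "nat \<Rightarrow> real ^ 'p \<Rightarrow> real"
    and \<epsilon> :: "nat \<Rightarrow> nat \<Rightarrow> 'a \<Rightarrow> real"
    and \<sigma> d \<tau> :: real
    and lam :: "nat \<Rightarrow> real"
    and \<Gamma> :: "nat \<Rightarrow> 'k set"
    and B :: "nat \<Rightarrow> 'k \<Rightarrow> (real ^ 'p \<Rightarrow> real) list"
    and kstar :: "nat \<Rightarrow> 'k"
    and khat :: "nat \<Rightarrow> 'a \<Rightarrow> 'k"
    and Y :: "nat \<Rightarrow> 'a \<Rightarrow> real Matrix.vec"
    and r :: "nat \<Rightarrow> 'k \<Rightarrow> nat"
    and A :: "nat \<Rightarrow> real"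
  defines "Y \<equiv> \<lambda>n \<omega>. response_vec n (x n) (f n) (\<lambda>i. \<epsilon> n i \<omega>)"
    and "r \<equiv> \<lambda>n k. model_rank n (x n) (B n k)"
    and "A \<equiv> \<lambda>n. signal_gap n (x n) (B n) (\<Gamma> n) (f n) \<sigma> (kstar n)"
  assumes prob: "prob_space P"
    and sigma_pos: "\<sigma> > 0"
    and errors_indep: "\<And>n. prob_space.indep_vars P (\<lambda>_. borel) (\<epsilon> n) {..<n}"
    and errors_normal: "\<And>n i. i < n \<Longrightarrow> distributed P lborel (\<epsilon> n i) (normal_density 0 \<sigma>)"
    and d_nonneg: "d \<ge> 0"
    and lam_ge: "\<And>n. n \<ge> 2 \<Longrightarrow> lam n \<ge> 1 / ln (real n)"
    and submodels_nonempty: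
      "\<And>n k. k \<in> \<Gamma> n \<Longrightarrow> r n k > 1 \<Longrightarrow> submodels1 n (x n) (B n) (\<Gamma> n) k \<noteq> {}"
    and selected: "\<And>n \<omega>. \<omega> \<in> space P \<Longrightarrow> khat n \<omega> \<in> \<Gamma> n"
    and selected_measurable: "\<And>n k. k \<in> \<Gamma> n \<Longrightarrow> {\<omega>\<in>space P. khat n \<omega> = k} \<in> sets P"
    and true_model: "\<forall>\<^sub>F n in sequentially.
      kstar n \<in> \<Gamma> n \<and> f n \<in> regression_family (B n (kstar n)) \<and> r n (kstar n) > 1"
    and tau: "0 < \<tau>" "\<tau> \<le> 1 / 2"
    and P1: "liminf (\<lambda>n. ereal (A n / real n powr (1 / 2 + \<tau>))) > 0"
    and P2: "(\<lambda>n. real (r n (kstar n)) * lam n * ln (real n)) \<in> o(\<lambda>n. real n powr (1 / 2 + \<tau>))"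
    and P3: "(\<lambda>n. measure P {\<omega>\<in>space P. khat n \<omega> = kstar n}) \<longlonglongrightarrow> 1"
  shows
    "(d > 0 \<or> filterlim (\<lambda>n. (lam n * ln (real n) - 1) * real (r n (kstar n)) / sqrt (real n))
                at_top sequentially \<longrightarrow>
      tends_to_infinity_in_prob P
        (\<lambda>n \<omega>. param_index n (x n) (B n) (\<Gamma> n) (lam n) d (\<sigma>\<^sup>2) (Y n \<omega>) (khat n \<omega>))) \<and>
     tends_to_infinity_in_prob P
        (\<lambda>n \<omega>. \<bar>param_index n (x n) (B n) (\<Gamma> n) (lam n) d (\<sigma>\<^sup>2) (Y n \<omega>) (khat n \<omega>)\<bar>) \<and>
     tends_to_infinity_in_prob P
        (\<lambda>n \<omega>. param_index n (x n) (B n) (\<Gamma> n) (lam n) d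
                  (sigma2_hat n (x n) (B n (khat n \<omega>)) (Y n \<omega>)) (Y n \<omega>) (khat n \<omega>))"
proof -
  interpret prob_space P by (rule prob)
  have iid: "iid_normal P (\<epsilon> n) n \<sigma>" for n
    using sigma_pos errors_indep errors_normal prob
    by (simp add: iid_normal_def iid_normal_axioms_def)

  \<comment> \<open>Good events and their probabilities\<close>
  define M where "M n = proj_mat n (x n) (B n (kstar n))" for n
  define pen where "pen n = lam n * ln (real n)" for n
  define R where "R n = real (r n (kstar n))" for n
  define dev where "dev n = d * sqrt (real n) * ln (real n)" for n
  define K where "K n = {\<omega> \<in> space P. khat n \<omega> = kstar n}" for n
  define SS where "SS a n = {\<omega> \<in> space P.
    \<bar>(\<Sum>i<n. (\<epsilon> n i \<omega>)\<^sup>2) - real n * \<sigma>\<^sup>2\<bar> < a n * sqrt (real n) * \<sigma>\<^sup>2}" for a :: "nat \<Rightarrow> real" and n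
  define FS where "FS a n = {\<omega> \<in> space P.
    \<bar>fitted_ss n (x n) (B n (kstar n)) (\<lambda>i. \<epsilon> n i \<omega>) - mat_trace (M n) * \<sigma>\<^sup>2\<bar>
      < a n * sqrt (real n) * \<sigma>\<^sup>2}" for a :: "nat \<Rightarrow> real" and n
  define G where "G a n = K n \<inter> (SS a n \<inter> FS a n)" for a :: "nat \<Rightarrow> real" and n

  have M: "orth_proj n (model_space n (x n) (B n (kstar n))) (M n)" for n
    unfolding M_def by (rule orth_proj_proj_mat)
  \<comment> \<open>\<open>kstar n\<close> is known to lie in \<open>\<Gamma> n\<close> only
    eventually. Otherwise the event is empty, since the selected index always belongs to
    \<open>\<Gamma> n\<close>.\<close>
  have K: "K n \<in> events" for n
  proof (cases "kstar n \<in> \<Gamma> n")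
    case True
    then show ?thesis unfolding K_def by (rule selected_measurable)
  next
    case False
    then have "K n = {}" unfolding K_def using selected[of _ n] by fastforce
    then show ?thesis by simp
  qed
  have G: "G a n \<in> events" "(\<lambda>n. prob (G a n)) \<longlonglongrightarrow> 1"
    if a: "filterlim a at_top sequentially" for a n
  proof -
    \<comment> \<open>The identity array presents the sum of squared errors as a quadratic form of
      trace \<open>n\<close>, so one concentration lemma serves both statistics.\<close>
    define I where "I n i j = (if i = j then 1 else 0 :: real)" for n i j :: nat
    have I2: "(\<Sum>i<n. \<Sum>j<n. (I n i j)\<^sup>2) \<le> real n" for n
      by (simp add: I_def if_distrib[of "\<lambda>y. y\<^sup>2"] cong: if_cong)
    have SS_eq: "SS a n = {\<omega> \<in> space P. \<bar>(\<Sum>i<n. \<Sum>j<n. I n i j * (\<epsilon> n i \<omega> * \<epsilon> n j \<omega>))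
        - (\<Sum>i<n. I n i i) * \<sigma>\<^sup>2\<bar> < a n * sqrt (real n) * \<sigma>\<^sup>2}" for n
      by (simp add: SS_def I_def if_distrib power2_eq_square if_distribR cong: if_cong)
    have SS: "SS a n \<in> events" "(\<lambda>n. prob (SS a n)) \<longlonglongrightarrow> 1" for n
      unfolding SS_eq by (rule qform_event_tendsto_1[OF iid _ I2 a]; simp add: I_def)+
    have M2: "(\<Sum>i<n. \<Sum>j<n. (M n $$ (i, j))\<^sup>2) \<le> real n" for n
      using orth_proj.sum_squares_eq_trace[OF M] orth_proj.mat_trace_le[OF M] by simp
    have FS_eq: "FS a n = {\<omega> \<in> space P. \<bar>(\<Sum>i<n. \<Sum>j<n. M n $$ (i, j) * (\<epsilon> n i \<omega> * \<epsilon> n j \<omega>))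
        - (\<Sum>i<n. M n $$ (i, i)) * \<sigma>\<^sup>2\<bar> < a n * sqrt (real n) * \<sigma>\<^sup>2}" for n
      unfolding FS_def fitted_ss_def orth_proj.mat_trace_eq[OF M] M_def[symmetric] ..
    have FS: "FS a n \<in> events" "(\<lambda>n. prob (FS a n)) \<longlonglongrightarrow> 1" for n
      unfolding FS_eq
      by (rule qform_event_tendsto_1[OF iid orth_proj.proj_symmetric[OF M] M2 a]; assumption)+
    show "G a n \<in> events" unfolding G_def using K SS(1) FS(1) by (intro sets.Int)
    have K_lim: "(\<lambda>n. prob (K n)) \<longlonglongrightarrow> 1" unfolding K_def by (rule P3)
    show "(\<lambda>n. prob (G a n)) \<longlonglongrightarrow> 1"
      unfolding G_def
      by (rule prob_Int_tendsto_1[OF K K_lim sets.Int[OF SS(1) FS(1)] prob_Int_tendsto_1[OF SS FS]])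
  qed

  \<comment> \<open>Asymptotic size of the error terms\<close>
  have pen_ge: "1 \<le> pen n" if "n \<ge> 2" for n
    using lam_ge[OF that] that by (simp add: pen_def divide_le_eq)
  have dev_ge: "0 \<le> dev n" if "n \<ge> 2" for n
    using d_nonneg that by (simp add: dev_def)

  \<comment> \<open>It has to diverge for the probabilities and to be \<open>o(n^\<tau>)\<close> for
    the comparison with the signal. The deviation parameter of \<open>good_errors\<close> is this
    rate times \<open>sqrt n\<close>.\<close>
  define \<alpha> where "\<alpha> n = real n powr (\<tau> / 2)" for n
  have \<alpha>: "filterlim \<alpha> at_top sequentially"
    unfolding \<alpha>_def using tau(1) by real_asymp
  define u where "u n = 2 * (\<alpha> n * sqrt (real n)) + R n + pen n * R n + dev n" for n
  have u_small: "u \<in> o(\<lambda>n. real n powr (1 / 2 + \<tau>))"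
    unfolding u_def \<alpha>_def dev_def
  proof (rule penalty_smallo[OF tau(1)])
    show "(\<lambda>n. pen n * R n) \<in> o(\<lambda>n. real n powr (1 / 2 + \<tau>))"
      using P2 by (simp add: pen_def R_def mult_ac)
    show "\<forall>\<^sub>F n in sequentially. 0 \<le> R n \<and> 1 \<le> pen n"
      using eventually_ge_at_top[of 2] by eventually_elim (simp add: R_def pen_ge)
  qed
  \<comment> \<open>Here \<open>\<tau> \<le> 1/2\<close> enters: the scale is at most
    \<open>n\<close>, so rank and deviation meet the smallness conditions of
    \<open>estimated_variance\<close>.\<close>
  have u_le: "\<forall>\<^sub>F n in sequentially. u n \<le> real n / 2"
  proof -
    have "\<forall>\<^sub>F n in sequentially. norm (u n) \<le> 1 / 2 * norm (real n powr (1 / 2 + \<tau>))"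
      by (rule landau_o.smallD[OF u_small]) simp
    then show ?thesis using eventually_ge_at_top[of 1]
    proof eventually_elim
      case (elim n)
      have "real n powr (1 / 2 + \<tau>) \<le> real n powr 1"
        using elim tau by (intro powr_mono) auto
      then show ?case using elim by simp
    qed
  qed
  have u_gap: "\<forall>\<^sub>F n in sequentially. (5 + 4 * C) * u n < A n / 2" if "C > 0" for C
  proof -
    have "\<forall>\<^sub>F n in sequentially. 2 * (5 + 4 * C) * u n < A n"
    proof (rule signal_dominates[OF P1 u_small])
      show "\<forall>\<^sub>F n in sequentially. 0 < real n powr (1 / 2 + \<tau>)"
        using eventually_gt_at_top[of 0] by eventually_elim simp
    qed (use that in simp)
    then show ?thesis by eventually_elim (simp add: algebra_simps)
  qed

  define good where "good n e a C \<longleftrightarrow>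
    good_errors n (x n) (f n) (B n) (\<Gamma> n) (kstar n) e (lam n) d \<sigma> (a n * sqrt (real n)) C"
    for n :: nat and e :: "nat \<Rightarrow> real" and a :: "nat \<Rightarrow> real" and C :: real
  have good: "\<forall>\<^sub>F n in sequentially. \<forall>\<omega>\<in>G a n. good n (\<lambda>i. \<epsilon> n i \<omega>) a C" if "C > 0" for a C
    using true_model eventually_ge_at_top[of 2]
  proof eventually_elim
    case (elim n)
    show ?case
    proof
      fix \<omega> assume "\<omega> \<in> G a n"
      then have "\<bar>(\<Sum>i<n. (\<epsilon> n i \<omega>)\<^sup>2) - real n * \<sigma>\<^sup>2\<bar> < a n * sqrt (real n) * \<sigma>\<^sup>2"
        "\<bar>fitted_ss n (x n) (B n (kstar n)) (\<lambda>i. \<epsilon> n i \<omega>) - mat_trace (M n) * \<sigma>\<^sup>2\<bar>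
          < a n * sqrt (real n) * \<sigma>\<^sup>2"
        by (simp_all add: G_def SS_def FS_def)
      then show "good n (\<lambda>i. \<epsilon> n i \<omega>) a C"
        unfolding good_def
        using elim submodels_nonempty[of "kstar n" n] sigma_pos d_nonneg lam_ge[of n] that
        by (intro good_errors.intro) (simp_all add: M_def r_def)
    qed
  qed
  have khat: "khat n \<omega> = kstar n" if "\<omega> \<in> G a n" for n \<omega> a
    using that by (simp add: G_def K_def)

  \<comment> \<open>Divergence of the three versions of the index\<close>
  have known: "tends_to_infinity_in_prob P
      (\<lambda>n \<omega>. param_index n (x n) (B n) (\<Gamma> n) (lam n) d (\<sigma>\<^sup>2) (Y n \<omega>) (khat n \<omega>))"
    if div: "d > 0 \<or> filterlim (\<lambda>n. (lam n * ln (real n) - 1) * real (r n (kstar n)) / sqrt (real n))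
                at_top sequentially"
  proof (rule tends_to_infinity_in_probI[OF prob])
    fix C :: real assume C: "C > 0"
    \<comment> \<open>Half of the surplus divided by \<open>sqrt n\<close>: with this rate the
      assumption of \<open>info_crit_nonneg\<close> holds with equality.\<close>
    define w where "w n = ((pen n - 1) * R n + dev n) / sqrt (real n) / 2" for n
    have w: "filterlim w at_top sequentially"
      using div
    proof
      assume "d > 0"
      then have "filterlim (\<lambda>n. d * ln (real n) / 2) at_top sequentially" by real_asymp
      then show ?thesis
      proof (rule filterlim_at_top_mono)
        show "\<forall>\<^sub>F n in sequentially. d * ln (real n) / 2 \<le> w n"
          using eventually_ge_at_top[of 2]
        proof eventually_elim
          case (elim n)
          have "0 \<le> (pen n - 1) * R n" using pen_ge[OF elim] by (simp add: R_def)
          then show ?case using elim by (simp add: w_def dev_def field_simps)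
        qed
      qed
    next
      assume "filterlim (\<lambda>n. (lam n * ln (real n) - 1) * real (r n (kstar n)) / sqrt (real n))
                at_top sequentially"
      then have "filterlim (\<lambda>n. (1 / 2) * ((pen n - 1) * R n / sqrt (real n))) at_top sequentially"
        unfolding pen_def R_def by (intro filterlim_tendsto_pos_mult_at_top[OF tendsto_const]) simp_all
      then show ?thesis
      proof (rule filterlim_at_top_mono)
        show "\<forall>\<^sub>F n in sequentially. (1 / 2) * ((pen n - 1) * R n / sqrt (real n)) \<le> w n"
          using eventually_ge_at_top[of 2]
        proof eventually_elim
          case (elim n)
          have "(pen n - 1) * R n / sqrt (real n) \<le> ((pen n - 1) * R n + dev n) / sqrt (real n)"
            using dev_ge[OF elim] by (intro divide_right_mono) simp_all
          then show ?case by (simp add: w_def)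
        qed
      qed
    qed
    \<comment> \<open>The gap is available at rate \<open>\<alpha>\<close>, which may grow faster
      than \<open>w\<close>; the sign of the criterion is controlled at rate \<open>w\<close>. Both
      events have probability tending to 1, so they are intersected.\<close>
    have "\<forall>\<^sub>F n in sequentially. \<forall>\<omega>\<in>G \<alpha> n \<inter> G w n.
        ereal C \<le> param_index n (x n) (B n) (\<Gamma> n) (lam n) d (\<sigma>\<^sup>2) (Y n \<omega>) (khat n \<omega>)"
      using good[OF C, of \<alpha>] good[OF C, of w] u_gap[OF C] eventually_ge_at_top[of 2]
    proof eventually_elim
      case (elim n)
      show ?case
      proof
        fix \<omega> assume \<omega>: "\<omega> \<in> G \<alpha> n \<inter> G w n"
        interpret L: good_errors n "x n" "f n" "B n" "\<Gamma> n" "kstar n" "\<lambda>i. \<epsilon> n i \<omega>" "lam n" d \<sigma>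
            "\<alpha> n * sqrt (real n)" C
          using elim(1) \<omega> unfolding good_def by blast
        interpret W: good_errors n "x n" "f n" "B n" "\<Gamma> n" "kstar n" "\<lambda>i. \<epsilon> n i \<omega>" "lam n" d \<sigma>
            "w n * sqrt (real n)" C
          using elim(2) \<omega> unfolding good_def by blast
        have khat_eq: "khat n \<omega> = kstar n" using khat \<omega> by blast
        have gap: "(5 + 4 * C) * (2 * (\<alpha> n * sqrt (real n)) + L.rk + L.pen * L.rk + L.dev)
            < signal_gap n (x n) (B n) (\<Gamma> n) (f n) \<sigma> (kstar n) / 2"
          using elim(3) by (simp add: u_def pen_def R_def dev_def r_def A_def)
        have "2 * (w n * sqrt (real n)) = (L.pen - 1) * L.rk + L.dev"
          using elim(4) by (simp add: w_def pen_def R_def dev_def r_def)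
        then have nonneg: "0 \<le> info_crit n (x n) (lam n) d (\<sigma>\<^sup>2) L.y (B n (kstar n))"
          by (intro W.info_crit_nonneg) simp
        show "ereal C \<le> param_index n (x n) (B n) (\<Gamma> n) (lam n) d (\<sigma>\<^sup>2) (Y n \<omega>) (khat n \<omega>)"
          unfolding khat_eq Y_def
          by (rule param_index_ge[of n "x n" "B n" "kstar n", OF L.rank_gt_1 L.known_variance[OF gap] nonneg])
      qed
    qed
    moreover have "G \<alpha> n \<inter> G w n \<in> events" for n using G(1)[OF \<alpha>] G(1)[OF w] by (intro sets.Int)
    moreover have "(\<lambda>n. prob (G \<alpha> n \<inter> G w n)) \<longlonglongrightarrow> 1"
      by (rule prob_Int_tendsto_1[OF G[OF \<alpha>] G[OF w]])
    ultimately show "\<exists>E. (\<forall>n. E n \<in> events) \<and> (\<lambda>n. prob (E n)) \<longlonglongrightarrow> 1 \<and>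
        (\<forall>\<^sub>F n in sequentially. \<forall>\<omega>\<in>E n.
          ereal C \<le> param_index n (x n) (B n) (\<Gamma> n) (lam n) d (\<sigma>\<^sup>2) (Y n \<omega>) (khat n \<omega>))"
      by (intro exI[of _ "\<lambda>n. G \<alpha> n \<inter> G w n"] conjI allI)
  qed

  \<comment> \<open>One rate suffices because the sign of the criterion at the true model stays
    open.\<close>
  have absolute: "tends_to_infinity_in_prob P
      (\<lambda>n \<omega>. \<bar>param_index n (x n) (B n) (\<Gamma> n) (lam n) d (\<sigma>\<^sup>2) (Y n \<omega>) (khat n \<omega>)\<bar>)"
  proof (rule tends_to_infinity_in_probI[OF prob])
    fix C :: real assume C: "C > 0"
    have "\<forall>\<^sub>F n in sequentially. \<forall>\<omega>\<in>G \<alpha> n.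
        ereal C \<le> \<bar>param_index n (x n) (B n) (\<Gamma> n) (lam n) d (\<sigma>\<^sup>2) (Y n \<omega>) (khat n \<omega>)\<bar>"
      using good[OF C, of \<alpha>] u_gap[OF C]
    proof eventually_elim
      case (elim n)
      show ?case
      proof
        fix \<omega> assume \<omega>: "\<omega> \<in> G \<alpha> n"
        interpret L: good_errors n "x n" "f n" "B n" "\<Gamma> n" "kstar n" "\<lambda>i. \<epsilon> n i \<omega>" "lam n" d \<sigma>
            "\<alpha> n * sqrt (real n)" C
          using elim(1) \<omega> unfolding good_def by blast
        show "ereal C \<le> \<bar>param_index n (x n) (B n) (\<Gamma> n) (lam n) d (\<sigma>\<^sup>2) (Y n \<omega>) (khat n \<omega>)\<bar>"
          unfolding khat[OF \<omega>] Y_def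
          by (rule abs_param_index_ge[OF L.rank_gt_1 L.submodels L.known_variance])
            (use elim(2) in \<open>simp_all add: u_def pen_def R_def dev_def r_def A_def\<close>)
      qed
    qed
    then show "\<exists>E. (\<forall>n. E n \<in> events) \<and> (\<lambda>n. prob (E n)) \<longlonglongrightarrow> 1 \<and>
        (\<forall>\<^sub>F n in sequentially. \<forall>\<omega>\<in>E n.
          ereal C \<le> \<bar>param_index n (x n) (B n) (\<Gamma> n) (lam n) d (\<sigma>\<^sup>2) (Y n \<omega>) (khat n \<omega>)\<bar>)"
      by (intro exI[of _ "G \<alpha>"] conjI allI G[OF \<alpha>])
  qed

  \<comment> \<open>The criterion at the true model is automatically nonnegative on the good event,
    so the signed claim follows at the single rate \<open>\<alpha>\<close>.\<close>
  have estimated: "tends_to_infinity_in_prob P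
      (\<lambda>n \<omega>. param_index n (x n) (B n) (\<Gamma> n) (lam n) d
         (sigma2_hat n (x n) (B n (khat n \<omega>)) (Y n \<omega>)) (Y n \<omega>) (khat n \<omega>))"
  proof (rule tends_to_infinity_in_probI[OF prob])
    fix C :: real assume C: "C > 0"
    have "\<forall>\<^sub>F n in sequentially. \<forall>\<omega>\<in>G \<alpha> n.
        ereal C \<le> param_index n (x n) (B n) (\<Gamma> n) (lam n) d
         (sigma2_hat n (x n) (B n (khat n \<omega>)) (Y n \<omega>)) (Y n \<omega>) (khat n \<omega>)"
      using good[OF C, of \<alpha>] u_gap[OF C] u_le eventually_ge_at_top[of 2]
    proof eventually_elim
      case (elim n)
      show ?case
      proof
        fix \<omega> assume \<omega>: "\<omega> \<in> G \<alpha> n"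
        interpret L: good_errors n "x n" "f n" "B n" "\<Gamma> n" "kstar n" "\<lambda>i. \<epsilon> n i \<omega>" "lam n" d \<sigma>
            "\<alpha> n * sqrt (real n)" C
          using elim(1) \<omega> unfolding good_def by blast
        have gap: "(5 + 4 * C) * (2 * (\<alpha> n * sqrt (real n)) + L.rk + L.pen * L.rk + L.dev)
            < signal_gap n (x n) (B n) (\<Gamma> n) (f n) \<sigma> (kstar n) / 2"
          using elim(2) by (simp add: u_def pen_def R_def dev_def r_def A_def)
        have "u n = 2 * (\<alpha> n * sqrt (real n)) + L.rk + L.pen * L.rk + L.dev"
          by (simp add: u_def pen_def R_def dev_def r_def)
        then have small: "\<alpha> n * sqrt (real n) \<le> real n" "L.rk \<le> real n / 2"
          using elim(3) L.alpha_pos L.rk_ge L.pen_rk L.dev_nonneg by linarith+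
        obtain k0 where k0: "k0 \<in> submodels1 n (x n) (B n) (\<Gamma> n) (kstar n)"
          using L.submodels by blast
        show "ereal C \<le> param_index n (x n) (B n) (\<Gamma> n) (lam n) d
            (sigma2_hat n (x n) (B n (khat n \<omega>)) (Y n \<omega>)) (Y n \<omega>) (khat n \<omega>)"
          unfolding khat[OF \<omega>] Y_def
          by (rule param_index_ge[of n "x n" "B n" "kstar n", OF L.rank_gt_1
                L.estimated_variance(2)[OF gap small] L.estimated_variance(1)[OF gap small k0]])
      qed
    qed
    then show "\<exists>E. (\<forall>n. E n \<in> events) \<and> (\<lambda>n. prob (E n)) \<longlonglongrightarrow> 1 \<and>
        (\<forall>\<^sub>F n in sequentially. \<forall>\<omega>\<in>E n.
          ereal C \<le> param_index n (x n) (B n) (\<Gamma> n) (lam n) d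
         (sigma2_hat n (x n) (B n (khat n \<omega>)) (Y n \<omega>)) (Y n \<omega>) (khat n \<omega>))"
      by (intro exI[of _ "G \<alpha>"] conjI allI G[OF \<alpha>])
  qed
  show ?thesis by (intro conjI impI known absolute estimated)
qed

end
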